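(* Let $q$ be a prime power, let $n$ be a positive integer, let $\overline{H}$ satisfy $\mathrm{PSL}_n(q)\le\overline{H}\le\mathrm{P\Gamma L}_n(q)$, and let $e:=|\overline{H}:\overline{H}\cap\mathrm{PGL}_n(q)|$. Fix $m\in\{2,\ldots,\lfloor n/2\rfloor\}$, and let $\Omega_m$ be the set of $m$-dimensional subspaces of $\mathbb{F}_q^n$. Then $$(m+1)n-2m+2+\omega(e)\ \ge\ \mathrm{RC}(\overline{H},\Omega_m)\ \ge\ mn-m^2+1.$$
   Context: Relational complexity: let a group $H$ act on a set $\Omega$ (on the right, $x\mapsto x^h$). For $X=(x_1,\ldots,x_k),\,Y=(y_1,\ldots,y_k)\in\Omega^k$ and $r\le k$, say that $X$ and $Y$ are $r$-equivalent under $H$ if for every $r$-subset $\{i_1,\ldots,i_r\}\subseteq\{1,\ldots,k\}$ there exists $h\in H$ with $(x_{i_1}^h,\ldots,x_{i_r}^h)=(y_{i_1},\ldots,y_{i_r})$. The relational complexity $\mathrm{RC}(H,\Omega)$ is the smallest $r\ge 1$ such that, for all $k\ge r$ and all $X,Y\in\Omega^k$, $r$-equivalence of $X$ and $Y$ under $H$ implies $Y\in X^H$. For a positive integer $k$, $\omega(k)$ is the number of distinct prime divisors of $k$, with $\omega(1)=0$. $\mathrm{P\Gamma L}_n(q)$ is the group of semilinear bijections of $\mathbb{F}_q^n$ modulo scalars, acting naturally on $\Omega_m$. *)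

theory Defs
  imports
    "HOL-Analysis.Determinants"
    "HOL-Algebra.Group_Action"
    "HOL-Computational_Algebra.Primes"
begin

section \<open>Relational complexity\<close>

text \<open>
  An action is given by a set \<open>H\<close> of group elements and a map \<open>\<phi>\<close> sending each of them to a
  permutation of \<open>\<Omega>\<close>, as in the locale \<^locale>\<open>group_action\<close>. Tuples are lists, with entries
  indexed from 0. The locale describes left actions; replacing \<open>\<phi> h\<close> by \<open>\<phi> (inv h)\<close> turns a left
  action of a group into a right one and affects none of the notions below.
\<close>

definition r_equivalent :: "nat \<Rightarrow> 'g set \<Rightarrow> ('g \<Rightarrow> 'x \<Rightarrow> 'x) \<Rightarrow> 'x list \<Rightarrow> 'x list \<Rightarrow> bool"
  where "r_equivalent r H \<phi> X Y \<longleftrightarrow>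
    (\<forall>I. I \<subseteq> {..<length X} \<and> card I = r \<longrightarrow> (\<exists>h\<in>H. \<forall>i\<in>I. \<phi> h (X ! i) = Y ! i))"

definition RC_bound :: "'g set \<Rightarrow> 'x set \<Rightarrow> ('g \<Rightarrow> 'x \<Rightarrow> 'x) \<Rightarrow> nat \<Rightarrow> bool"
  where "RC_bound H \<Omega> \<phi> r \<longleftrightarrow> 1 \<le> r \<and>
    (\<forall>k\<ge>r. \<forall>X Y. length X = k \<and> length Y = k \<and> set X \<subseteq> \<Omega> \<and> set Y \<subseteq> \<Omega> \<and> r_equivalent r H \<phi> X Y
      \<longrightarrow> (\<exists>h\<in>H. map (\<phi> h) X = Y))"

definition relational_complexity :: "'g set \<Rightarrow> 'x set \<Rightarrow> ('g \<Rightarrow> 'x \<Rightarrow> 'x) \<Rightarrow> nat"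
  where "relational_complexity H \<Omega> \<phi> = (LEAST r. RC_bound H \<Omega> \<phi> r)"

text \<open>For finite \<open>\<Omega>\<close> the minimum is attained, so \<open>LEAST\<close> is meaningful.\<close>

lemma RC_bound_exists:
  assumes "finite \<Omega>"
  shows "\<exists>r. RC_bound H \<Omega> \<phi> r"
proof -
  define r where "r = Suc (card (\<Omega> \<times> \<Omega>))"
  have "\<exists>h\<in>H. map (\<phi> h) X = Y"
    if len: "r \<le> length X" "length Y = length X" and sub: "set X \<subseteq> \<Omega>" "set Y \<subseteq> \<Omega>"
      and eq: "r_equivalent r H \<phi> X Y" for X Y
  proof -
    define p where "p i = (X ! i, Y ! i)" for i
    define g where "g c = (SOME i. i < length X \<and> p i = c)" for c
    have g: "g (p i) < length X \<and> p (g (p i)) = p i" if "i < length X" for i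
      unfolding g_def by (rule someI[of _ i]) (use that in auto)
    define J where "J = g ` p ` {..<length X}"
    have "p ` {..<length X} \<subseteq> \<Omega> \<times> \<Omega>"
      using sub len by (auto simp: p_def subset_iff)
    then have "card (p ` {..<length X}) \<le> card (\<Omega> \<times> \<Omega>)"
      using assms by (intro card_mono) auto
    then have cJ: "card J \<le> r"
      unfolding J_def r_def using card_image_le[of "p ` {..<length X}" g] by simp
    have sJ: "J \<subseteq> {..<length X}"
      unfolding J_def using g by auto
    obtain I where I: "J \<subseteq> I" "I \<subseteq> {..<length X}" "card I = r"
      using exists_subset_between[of J r "{..<length X}"] cJ sJ len by auto
    then obtain h where h: "h \<in> H" "\<forall>i\<in>I. \<phi> h (X ! i) = Y ! i"
      using eq unfolding r_equivalent_def by blast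
    have "\<phi> h (X ! i) = Y ! i" if "i < length X" for i
    proof -
      have "g (p i) \<in> I"
        using that I(1) unfolding J_def by auto
      with h g[OF that] show ?thesis
        unfolding p_def by auto
    qed
    then have "map (\<phi> h) X = Y"
      using len by (intro nth_equalityI) auto
    with h show ?thesis by blast
  qed
  then have "RC_bound H \<Omega> \<phi> r"
    unfolding RC_bound_def by (auto simp: r_def)
  then show ?thesis ..
qed


section \<open>Projective semilinear groups\<close>

text \<open>
  The field \<open>\<F>\<^sub>q\<close> is a type \<open>'a\<close> of classes \<open>field\<close> and \<open>finite\<close>, and \<open>\<F>\<^sub>q\<^sup>n\<close> is \<open>'a ^ 'n\<close>.
\<close>

definition field_automorphism :: "('a::field \<Rightarrow> 'a) \<Rightarrow> bool"
  where "field_automorphism \<sigma> \<longleftrightarrow> bij \<sigma> \<and> \<sigma> 1 = 1 \<and>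
    (\<forall>x y. \<sigma> (x + y) = \<sigma> x + \<sigma> y) \<and> (\<forall>x y. \<sigma> (x * y) = \<sigma> x * \<sigma> y)"

definition semilinear :: "('a::field ^ 'n \<Rightarrow> 'a ^ 'n) \<Rightarrow> bool"
  where "semilinear f \<longleftrightarrow> (\<exists>\<sigma>. field_automorphism \<sigma> \<and>
    (\<forall>u v. f (u + v) = f u + f v) \<and> (\<forall>c v. f (c *s v) = \<sigma> c *s f v))"

definition GammaL :: "('a::field ^ 'n \<Rightarrow> 'a ^ 'n) monoid"
  where "GammaL = \<lparr>carrier = {f. bij f \<and> semilinear f}, mult = (\<circ>), one = id\<rparr>"

definition GL :: "('a::field ^ 'n \<Rightarrow> 'a ^ 'n) set"
  where "GL = {f. bij f \<and> Vector_Spaces.linear (*s) (*s) f}"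

definition SL :: "('a::field ^ 'n \<Rightarrow> 'a ^ 'n) set"
  where "SL = {f \<in> GL. det (matrix f) = 1}"

definition scalars :: "('a::field ^ 'n \<Rightarrow> 'a ^ 'n) set"
  where "scalars = {(*s) c | c. c \<noteq> 0}"

definition PGammaL :: "('a::field ^ 'n \<Rightarrow> 'a ^ 'n) set monoid"
  where "PGammaL = GammaL Mod scalars"

text \<open>\<open>PGL\<close> and \<open>PSL\<close> are the images of \<open>GL\<close> and \<open>SL\<close> in \<open>PGammaL\<close>.\<close>

definition PGL :: "('a::field ^ 'n \<Rightarrow> 'a ^ 'n) set set"
  where "PGL = (\<lambda>f. scalars #>\<^bsub>GammaL\<^esub> f) ` GL"

definition PSL :: "('a::field ^ 'n \<Rightarrow> 'a ^ 'n) set set"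
  where "PSL = (\<lambda>f. scalars #>\<^bsub>GammaL\<^esub> f) ` SL"

definition group_index :: "('g, 'b) monoid_scheme \<Rightarrow> 'g set \<Rightarrow> 'g set \<Rightarrow> nat"
  where "group_index G H K = card (rcosets\<^bsub>G\<lparr>carrier := H\<rparr>\<^esub> K)"


section \<open>Action on subspaces\<close>

definition subspaces_of_dim :: "nat \<Rightarrow> ('a::field ^ 'n) set set"
  where "subspaces_of_dim m = {U. vec.subspace U \<and> vec.dim U = m}"

text \<open>
  A coset \<open>C\<close> of the scalars maps \<open>U\<close> to the common value of \<open>f ` U\<close> for \<open>f \<in> C\<close>;
  see \<open>subspace_action_eq\<close> and \<open>subspace_action_group_action\<close> below.
\<close>

definition subspace_action ::
    "nat \<Rightarrow> ('a::field ^ 'n \<Rightarrow> 'a ^ 'n) set \<Rightarrow> ('a ^ 'n) set \<Rightarrow> ('a ^ 'n) set"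
  where "subspace_action m C = (\<lambda>U \<in> subspaces_of_dim m. the_elem ((\<lambda>f. f ` U) ` C))"

lemma field_automorphism_inv:
  assumes "field_automorphism \<sigma>"
  shows "field_automorphism (inv_into UNIV \<sigma>)"
proof -
  have b: "bij \<sigma>" using assms by (simp add: field_automorphism_def)
  have i: "inv_into UNIV \<sigma> (\<sigma> x) = x" "\<sigma> (inv_into UNIV \<sigma> x) = x" for x
    using b by (simp_all add: bij_is_inj bij_is_surj surj_f_inv_f)
  show ?thesis
    using assms b unfolding field_automorphism_def
    by (metis bij_imp_bij_inv i)
qed

lemma semilinear_comp:
  assumes "semilinear f" "semilinear g"
  shows "semilinear (f \<circ> g)"
proof -
  obtain \<sigma> \<tau> where *: "field_automorphism \<sigma>" "field_automorphism \<tau>"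
    "\<And>u v. f (u + v) = f u + f v" "\<And>c v. f (c *s v) = \<sigma> c *s f v"
    "\<And>u v. g (u + v) = g u + g v" "\<And>c v. g (c *s v) = \<tau> c *s g v"
    using assms unfolding semilinear_def by metis
  have "field_automorphism (\<sigma> \<circ> \<tau>)"
    using *(1,2) by (auto simp: field_automorphism_def bij_comp)
  then show ?thesis
    unfolding semilinear_def using * by (intro exI[of _ "\<sigma> \<circ> \<tau>"]) auto
qed

lemma semilinear_inv:
  assumes "semilinear f" "bij f"
  shows "semilinear (inv_into UNIV f)"
proof -
  obtain \<sigma> where *: "field_automorphism \<sigma>"
    "\<And>u v. f (u + v) = f u + f v" "\<And>c v. f (c *s v) = \<sigma> c *s f v"
    using assms unfolding semilinear_def by metis
  have b: "bij \<sigma>" using * by (simp add: field_automorphism_def)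
  have i: "inv_into UNIV f (f x) = x" "f (inv_into UNIV f x) = x" for x
    using assms(2) by (simp_all add: bij_is_inj bij_is_surj surj_f_inv_f)
  have j: "\<sigma> (inv_into UNIV \<sigma> x) = x" for x
    using b by (simp add: bij_is_surj surj_f_inv_f)
  have "inv_into UNIV f (u + v) = inv_into UNIV f u + inv_into UNIV f v" for u v
    using i *(2) by metis
  moreover have "inv_into UNIV f (c *s v) = inv_into UNIV \<sigma> c *s inv_into UNIV f v" for c v
    using i j *(3) by metis
  ultimately show ?thesis
    unfolding semilinear_def using field_automorphism_inv[OF *(1)] by blast
qed

lemma field_automorphism_id: "field_automorphism id"
  by (auto simp: field_automorphism_def)

lemma semilinear_id: "semilinear id"
  unfolding semilinear_def using field_automorphism_id by (intro exI[of _ id]) auto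

lemma GL_semilinear: "f \<in> GL \<Longrightarrow> semilinear f"
  unfolding semilinear_def GL_def
  using field_automorphism_id
  by (intro exI[of _ id]) (auto simp: vec.linear_add vec.linear_scale)

lemma scalars_subset_GL: "scalars \<subseteq> (GL :: ('a::field ^ 'n \<Rightarrow> 'a ^ 'n) set)"
proof
  fix f :: "'a ^ 'n \<Rightarrow> 'a ^ 'n"
  assume "f \<in> scalars"
  then obtain c where c: "c \<noteq> 0" "f = (*s) c" by (auto simp: scalars_def)
  have "bij f"
    by (rule o_bij[of "(*s) (inverse c)"]) (use c in \<open>auto simp: fun_eq_iff\<close>)
  moreover have "Vector_Spaces.linear (*s) (*s) f"
    unfolding c(2) by (rule vec.linear_scale_self)
  ultimately show "f \<in> GL" by (simp add: GL_def)
qed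

lemma group_GammaL: "group GammaL"
proof (rule groupI)
  fix f assume "f \<in> carrier GammaL"
  then show "\<exists>g\<in>carrier GammaL. g \<otimes>\<^bsub>GammaL\<^esub> f = \<one>\<^bsub>GammaL\<^esub>"
    by (intro bexI[of _ "inv_into UNIV f"])
      (auto simp: GammaL_def semilinear_inv bij_imp_bij_inv bij_is_inj)
qed (auto simp: GammaL_def semilinear_comp bij_comp o_assoc semilinear_id)

lemma normal_scalars: "scalars \<lhd> (GammaL :: ('a::field ^ 'n \<Rightarrow> 'a ^ 'n) monoid)"
proof -
  let ?G = "GammaL :: ('a ^ 'n \<Rightarrow> 'a ^ 'n) monoid"
  interpret group ?G by (rule group_GammaL)
  have sub: "scalars \<subseteq> carrier ?G"
    using scalars_subset_GL GL_semilinear by (fastforce simp: GammaL_def GL_def)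
  have inv_eq: "inv\<^bsub>GammaL\<^esub> f = g" if "f \<in> carrier ?G" "g \<in> carrier ?G" "g \<circ> f = id" for f g
    using inv_equality[of g f] that by (simp add: GammaL_def)
  have "subgroup scalars ?G"
  proof (rule subgroupI)
    show "scalars \<subseteq> carrier ?G" by (fact sub)
    show "(scalars :: ('a ^ 'n \<Rightarrow> 'a ^ 'n) set) \<noteq> {}" using one_neq_zero unfolding scalars_def by blast
    fix f :: "'a ^ 'n \<Rightarrow> 'a ^ 'n"
    assume f: "f \<in> scalars"
    then obtain c where c: "c \<noteq> 0" "f = (*s) c" by (auto simp: scalars_def)
    have g: "((*s) (inverse c) :: 'a ^ 'n \<Rightarrow> 'a ^ 'n) \<in> scalars" using c by (auto simp: scalars_def)
    have "inv\<^bsub>GammaL\<^esub> f = (*s) (inverse c)"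
      by (rule inv_eq[OF subsetD[OF sub f] subsetD[OF sub g]])
        (use c in \<open>simp add: fun_eq_iff\<close>)
    with g show "inv\<^bsub>GammaL\<^esub> f \<in> scalars" by simp
    fix h :: "'a ^ 'n \<Rightarrow> 'a ^ 'n"
    assume "h \<in> scalars"
    then obtain d where d: "d \<noteq> 0" "h = (*s) d" by (auto simp: scalars_def)
    have "f \<circ> h = (*s) (c * d)" unfolding c(2) d(2) by (simp add: fun_eq_iff)
    moreover have "c * d \<noteq> 0" using c d by simp
    ultimately show "f \<otimes>\<^bsub>GammaL\<^esub> h \<in> scalars"
      unfolding GammaL_def scalars_def by auto
  qed
  moreover have "f \<otimes>\<^bsub>GammaL\<^esub> h \<otimes>\<^bsub>GammaL\<^esub> inv\<^bsub>GammaL\<^esub> f \<in> scalars"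
    if f: "f \<in> carrier ?G" and h: "h \<in> scalars" for f h
  proof -
    have b: "bij f" "semilinear f" using f by (auto simp: GammaL_def)
    obtain \<sigma> where s: "field_automorphism \<sigma>" "\<And>c v. f (c *s v) = \<sigma> c *s f v"
      using b unfolding semilinear_def by metis
    obtain c where c: "c \<noteq> 0" "h = (*s) c" using h by (auto simp: scalars_def)
    have "inv\<^bsub>GammaL\<^esub> f = inv_into UNIV f"
      by (rule inv_eq)
        (use f b in \<open>auto simp: GammaL_def semilinear_inv bij_imp_bij_inv bij_is_inj\<close>)
    then have "f \<otimes>\<^bsub>GammaL\<^esub> h \<otimes>\<^bsub>GammaL\<^esub> inv\<^bsub>GammaL\<^esub> f = (*s) (\<sigma> c)"
      using s c b by (auto simp: GammaL_def fun_eq_iff bij_is_surj surj_f_inv_f)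
    moreover have "\<sigma> c \<noteq> 0"
    proof
      assume z: "\<sigma> c = 0"
      have "\<sigma> (c * inverse c) = \<sigma> c * \<sigma> (inverse c)" "\<sigma> 1 = 1"
        using s(1) unfolding field_automorphism_def by blast+
      with z c show False by simp
    qed
    ultimately show ?thesis by (auto simp: scalars_def)
  qed
  ultimately show ?thesis by (simp add: normal_inv_iff)
qed

lemma group_PGammaL: "group PGammaL"
  unfolding PGammaL_def by (rule normal.factorgroup_is_group[OF normal_scalars])

lemma scale_image_subspace:
  assumes "vec.subspace U" "c \<noteq> (0::'a::field)"
  shows "(*s) c ` U = U"
proof
  show "(*s) c ` U \<subseteq> U" using assms by (auto simp: vec.subspace_scale)
  show "U \<subseteq> (*s) c ` U"
  proof
    fix u assume "u \<in> U"
    then have "inverse c *s u \<in> U" using assms by (auto simp: vec.subspace_scale)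
    moreover have "u = c *s (inverse c *s u)" using assms by simp
    ultimately show "u \<in> (*s) c ` U" by blast
  qed
qed

lemma semilinear_image_subspace:
  assumes "semilinear f" "vec.subspace U"
  shows "vec.subspace (f ` U)"
proof -
  obtain \<sigma> where s: "field_automorphism \<sigma>"
    "\<And>u v. f (u + v) = f u + f v" "\<And>c v. f (c *s v) = \<sigma> c *s f v"
    using assms unfolding semilinear_def by metis
  have z: "f 0 = 0" using s(2)[of 0 0] by simp
  show ?thesis
  proof (rule vec.subspaceI)
    show "0 \<in> f ` U" using z assms(2) vec.subspace_0 by force
    show "x + y \<in> f ` U" if "x \<in> f ` U" "y \<in> f ` U" for x y
      using that s(2) assms(2) vec.subspace_add by (metis (no_types, lifting) image_iff)
    show "c *s x \<in> f ` U" if "x \<in> f ` U" for c x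
    proof -
      obtain u where u: "u \<in> U" "x = f u" using \<open>x \<in> f ` U\<close> by blast
      have "\<sigma> (inv_into UNIV \<sigma> c) = c"
        using s(1) by (simp add: field_automorphism_def bij_is_surj surj_f_inv_f)
      then have "c *s x = f (inv_into UNIV \<sigma> c *s u)" using s(3) u by simp
      then show ?thesis using u assms(2) by (simp add: vec.subspace_scale)
    qed
  qed
qed

lemma semilinear_image_dim_le:
  fixes f :: "'a::field ^ 'n \<Rightarrow> 'a ^ 'n"
  assumes "semilinear f" "vec.subspace U"
  shows "vec.dim (f ` U) \<le> vec.dim U"
proof -
  obtain B where B: "B \<subseteq> U" "vec.independent B" "U \<subseteq> vec.span B" "card B = vec.dim U"
    using vec.basis_exists by blast
  have fin: "finite B" using B(2) by (rule vec.finiteI_independent)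
  define W where "W = {v. f v \<in> vec.span (f ` B)}"
  obtain \<sigma> where s:
    "\<And>u v. f (u + v) = f u + f v" "\<And>c v. f (c *s v) = \<sigma> c *s f v"
    using assms unfolding semilinear_def by metis
  have z: "f 0 = 0" using s(1)[of 0 0] by simp
  have "vec.subspace W"
    by (rule vec.subspaceI) (auto simp: W_def z s vec.span_zero vec.span_add vec.span_scale)
  moreover have "B \<subseteq> W" by (auto simp: W_def vec.span_base)
  ultimately have "vec.span B \<subseteq> W" by (simp add: vec.span_minimal)
  then have "f ` U \<subseteq> vec.span (f ` B)" using B(3) by (auto simp: W_def)
  then have "vec.dim (f ` U) \<le> card (f ` B)"
    by (rule vec.dim_le_card) (use fin in auto)
  also have "\<dots> \<le> vec.dim U" using card_image_le[OF fin, of f] B(4) by simp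
  finally show ?thesis .
qed

lemma GammaL_image_subspaces_of_dim:
  assumes "f \<in> carrier GammaL" "U \<in> subspaces_of_dim m"
  shows "f ` U \<in> subspaces_of_dim m"
proof -
  have f: "bij f" "semilinear f" using assms by (auto simp: GammaL_def)
  have U: "vec.subspace U" "vec.dim U = m" using assms by (auto simp: subspaces_of_dim_def)
  have fU: "vec.subspace (f ` U)" using f U by (simp add: semilinear_image_subspace)
  have "inv_into UNIV f ` f ` U = U" using f(1) by (simp add: image_image bij_is_inj)
  then have "vec.dim U \<le> vec.dim (f ` U)"
    using semilinear_image_dim_le[OF semilinear_inv[OF f(2,1)] fU] by simp
  then show ?thesis
    using semilinear_image_dim_le[OF f(2) U(1)] fU U(2) by (simp add: subspaces_of_dim_def)
qed

lemma subspace_action_eq: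
  assumes "f \<in> carrier GammaL" "U \<in> subspaces_of_dim m"
  shows "subspace_action m (scalars #>\<^bsub>GammaL\<^esub> f) U = f ` U"
proof -
  have f: "semilinear f" using assms by (auto simp: GammaL_def)
  have U: "vec.subspace U" using assms by (auto simp: subspaces_of_dim_def)
  have fU: "vec.subspace (f ` U)" using f U by (simp add: semilinear_image_subspace)
  have eq: "scalars #>\<^bsub>GammaL\<^esub> f = {(*s) c \<circ> f | c. c \<noteq> 0}"
    by (auto simp: r_coset_def scalars_def GammaL_def)
  have "((*s) c \<circ> f) ` U = f ` U" if "c \<noteq> 0" for c
    using scale_image_subspace[OF fU that] by (simp add: image_comp)
  moreover have "(*s) 1 \<circ> f \<in> scalars #>\<^bsub>GammaL\<^esub> f"
    unfolding eq using one_neq_zero by blast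
  ultimately have "(\<lambda>g. g ` U) ` (scalars #>\<^bsub>GammaL\<^esub> f) = {f ` U}"
    unfolding eq by blast
  then show ?thesis using assms(2) by (simp add: subspace_action_def)
qed

lemma subspace_action_group_action:
  "group_action (PGammaL :: ('a::field ^ 'n \<Rightarrow> 'a ^ 'n) set monoid)
     (subspaces_of_dim m) (subspace_action m)"
proof -
  interpret N: normal scalars "GammaL :: ('a ^ 'n \<Rightarrow> 'a ^ 'n) monoid" by (rule normal_scalars)
  have rep: "\<exists>f\<in>carrier GammaL. C = scalars #>\<^bsub>GammaL\<^esub> f" if "C \<in> carrier PGammaL"
    for C :: "('a ^ 'n \<Rightarrow> 'a ^ 'n) set"
    using that by (auto simp: PGammaL_def FactGroup_def RCOSETS_def)
  have bij: "subspace_action m (scalars #>\<^bsub>GammaL\<^esub> f) \<in> Bij (subspaces_of_dim m)"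
    if f: "f \<in> carrier GammaL" for f :: "'a ^ 'n \<Rightarrow> 'a ^ 'n"
  proof -
    have b: "bij f" "semilinear f" using f by (auto simp: GammaL_def)
    have i: "inv_into UNIV f \<in> carrier GammaL"
      using b by (auto simp: GammaL_def semilinear_inv bij_imp_bij_inv)
    have "bij_betw (\<lambda>U. f ` U) (subspaces_of_dim m) (subspaces_of_dim m)"
      by (rule bij_betw_byWitness[where f' = "\<lambda>U. inv_into UNIV f ` U"])
        (use b f i GammaL_image_subspaces_of_dim in
          \<open>auto simp: image_image bij_is_inj bij_is_surj surj_f_inv_f\<close>)
    then have "bij_betw (subspace_action m (scalars #>\<^bsub>GammaL\<^esub> f))
        (subspaces_of_dim m) (subspaces_of_dim m)"
      using bij_betw_cong[of "subspaces_of_dim m"] subspace_action_eq[OF f] by (metis (no_types, lifting))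
    then show ?thesis by (auto simp: Bij_def subspace_action_def)
  qed
  have "subspace_action m \<in> hom (PGammaL :: ('a ^ 'n \<Rightarrow> 'a ^ 'n) set monoid) (BijGroup (subspaces_of_dim m))"
  proof (rule homI)
    show "subspace_action m C \<in> carrier (BijGroup (subspaces_of_dim m))"
      if "C \<in> carrier PGammaL" for C :: "('a ^ 'n \<Rightarrow> 'a ^ 'n) set"
      using rep[OF that] bij by (auto simp: BijGroup_def)
    fix C D :: "('a ^ 'n \<Rightarrow> 'a ^ 'n) set"
    assume "C \<in> carrier PGammaL" "D \<in> carrier PGammaL"
    then obtain f g where fg: "f \<in> carrier GammaL" "C = scalars #>\<^bsub>GammaL\<^esub> f"
      "g \<in> carrier GammaL" "D = scalars #>\<^bsub>GammaL\<^esub> g"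
      using rep by meson
    have comp: "f \<circ> g \<in> carrier GammaL"
      using fg by (auto simp: GammaL_def semilinear_comp bij_comp)
    have "C \<otimes>\<^bsub>PGammaL\<^esub> D = scalars #>\<^bsub>GammaL\<^esub> (f \<otimes>\<^bsub>GammaL\<^esub> g)"
      using fg by (simp add: PGammaL_def N.rcos_sum)
    then have CD: "C \<otimes>\<^bsub>PGammaL\<^esub> D = scalars #>\<^bsub>GammaL\<^esub> (f \<circ> g)"
      by (simp add: GammaL_def)
    have "subspace_action m (C \<otimes>\<^bsub>PGammaL\<^esub> D) U
        = compose (subspaces_of_dim m) (subspace_action m C) (subspace_action m D) U" for U
    proof (cases "U \<in> subspaces_of_dim m")
      case True
      have "subspace_action m D U = g ` U"
        unfolding fg(4) by (rule subspace_action_eq[OF fg(3) True])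
      moreover have "subspace_action m C (g ` U) = f ` g ` U"
        unfolding fg(2)
        by (rule subspace_action_eq[OF fg(1) GammaL_image_subspaces_of_dim[OF fg(3) True]])
      moreover have "subspace_action m (C \<otimes>\<^bsub>PGammaL\<^esub> D) U = (f \<circ> g) ` U"
        unfolding CD by (rule subspace_action_eq[OF comp True])
      ultimately show ?thesis
        using True by (simp only: compose_eq image_comp)
    next
      case False
      then show ?thesis by (simp add: subspace_action_def compose_def)
    qed
    then show "subspace_action m (C \<otimes>\<^bsub>PGammaL\<^esub> D) =
        subspace_action m C \<otimes>\<^bsub>BijGroup (subspaces_of_dim m)\<^esub> subspace_action m D"
      using bij[OF fg(1)] bij[OF fg(3)] unfolding fg(2,4) BijGroup_def by (simp add: fun_eq_iff)
  qed
  then show ?thesis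
    unfolding group_action_def group_hom_def group_hom_axioms_def
    using group_PGammaL group_BijGroup by blast
qed

end

theory Submission
  imports "HOL-Algebra.Multiplicative_Group" Defs "HOL-Computational_Algebra.Polynomial"
begin

text \<open>
  Upper bound. If the pointwise stabiliser in \<open>H\<close> of a subtuple \<open>X\<^sub>I\<close> already fixes all of \<open>X\<close>, then
  \<open>(|I| + 1)\<close>-equivalence of \<open>X\<close> and \<open>Y\<close> implies \<open>Y \<in> X\<^sup>H\<close>: an element taking \<open>X\<^sub>I\<close> to \<open>Y\<^sub>I\<close> is determined
  up to the stabiliser of \<open>X\<close>. To find a small \<open>I\<close> for linear maps, start with two entries meeting
  in dimension \<open>d < m\<close> and extend greedily until the span \<open>S\<close> of the tuple is reached. With \<open>s = dim S\<close>,
  this takes at most \<open>2 + s - (2m - d)\<close> entries, and the algebra of endomorphisms of \<open>S\<close> preserving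
  them has dimension at most \<open>d\<^sup>2 + m(s - d)\<close>. Each further useful entry lowers this dimension,
  which never drops below 1 because of the scalars. The field automorphisms realised by the
  remaining semilinear stabilisers form subgroups of a cyclic group, and \<open>\<omega>(e)\<close> more entries
  suffice to cut out their intersection.

  Lower bound. There are \<open>m(n - m) + 1\<close> subspaces whose stabiliser conditions, restricted to the
  unipotent group \<open>Hom(\<F>\<^sup>n\<^sup>-\<^sup>m, \<F>\<^sup>m)\<close>, are inconsistent affine equations of which any \<open>m(n - m)\<close> are
  consistent.
\<close>

section \<open>Automorphisms of finite fields\<close>

lemma prime_CHAR_finite_field: "prime CHAR('a::{field,finite})"
  by (rule prime_CHAR_semidom) (rule finite_imp_CHAR_pos, simp)

text \<open>Exponents are natural numbers rather than residues modulo the order, so that composition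
  becomes addition and subgroups can be described by divisibility.\<close>

definition frob :: "nat \<Rightarrow> 'a::{field,finite} \<Rightarrow> 'a"
  where "frob t x = x ^ (CHAR('a) ^ t)"

lemma frob_0: "frob 0 = id"
  by (simp add: frob_def fun_eq_iff)

lemma frob_add: "frob (s + t) = frob s \<circ> frob t"
  by (simp add: frob_def fun_eq_iff power_add mult.commute flip: power_mult)

lemma field_automorphism_0:
  assumes "field_automorphism \<sigma>"
  shows "\<sigma> 0 = 0"
proof -
  have "\<sigma> (0 + 0) = \<sigma> 0 + \<sigma> 0"
    using assms unfolding field_automorphism_def by blast
  then have "\<sigma> 0 = \<sigma> 0 + \<sigma> 0"
    by (simp only: add_0_right)
  then show ?thesis
    by (simp only: add_cancel_right_right)
qed

lemma field_automorphism_power: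
  assumes "field_automorphism \<sigma>"
  shows "\<sigma> (x ^ n) = \<sigma> x ^ n"
  using assms by (induction n) (auto simp: field_automorphism_def)

lemma field_automorphism_sum:
  assumes "field_automorphism \<sigma>"
  shows "\<sigma> (sum f A) = (\<Sum>x\<in>A. \<sigma> (f x))"
  using assms field_automorphism_0[OF assms]
  by (induction A rule: infinite_finite_induct) (auto simp: field_automorphism_def)

lemma field_automorphism_of_nat:
  assumes "field_automorphism \<sigma>"
  shows "\<sigma> (of_nat n) = of_nat n"
  using assms field_automorphism_0[OF assms]
  by (induction n) (auto simp: field_automorphism_def)

text \<open>Additivity is the freshman's dream; it reduces injectivity to the absence of nilpotents,
  and finiteness gives surjectivity.\<close>

lemma field_automorphism_frob: "field_automorphism (frob t :: 'a::{field,finite} \<Rightarrow> 'a)"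
proof -
  have add: "frob t (x + y) = frob t x + frob t y" for x y :: 'a
    unfolding frob_def by (rule freshmans_dream'[OF prime_CHAR_finite_field refl])
  have "inj (frob t :: 'a \<Rightarrow> 'a)"
  proof (rule injI)
    fix x y :: 'a
    assume "frob t x = frob t y"
    moreover have "frob t ((x - y) + y) = frob t (x - y) + frob t y"
      by (rule add)
    ultimately have "frob t (x - y) = 0" by simp
    then show "x = y" by (simp add: frob_def)
  qed
  then have "bij (frob t :: 'a \<Rightarrow> 'a)"
    by (simp add: bij_def finite_UNIV_inj_surj)
  with add show ?thesis
    unfolding field_automorphism_def by (auto simp: frob_def power_mult_distrib)
qed

section \<open>Automorphisms applied to polynomial coefficients\<close>

lemma map_poly_automorphism_mult:
  assumes "field_automorphism \<sigma>"
  shows "map_poly \<sigma> (f * g) = map_poly \<sigma> f * map_poly \<sigma> g"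
  by (rule poly_eqI)
    (use assms in \<open>simp add: coeff_map_poly coeff_mult field_automorphism_0 field_automorphism_sum
      field_automorphism_def\<close>)

lemma map_poly_automorphism_prod:
  assumes "field_automorphism \<sigma>"
  shows "map_poly \<sigma> (prod f A) = (\<Prod>x\<in>A. map_poly \<sigma> (f x))"
proof -
  have "map_poly \<sigma> 1 = 1"
    by (rule poly_eqI)
      (use assms field_automorphism_0[OF assms] in \<open>auto simp: coeff_map_poly field_automorphism_def\<close>)
  then show ?thesis
    by (induction A rule: infinite_finite_induct) (auto simp: map_poly_automorphism_mult[OF assms])
qed

lemma poly_map_poly_automorphism:
  assumes "field_automorphism \<sigma>"
  shows "poly (map_poly \<sigma> f) (\<sigma> x) = \<sigma> (poly f x)"
  using assms field_automorphism_0[OF assms]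
  by (induction f) (auto simp: map_poly_pCons field_automorphism_def)

text \<open>The fixed points are the roots of \<open>X^p - X\<close>, at most \<open>p\<close> of
  them, and the \<open>p\<close> distinct multiples of 1 are roots already.\<close>

lemma frob_1_fixed:
  assumes "frob 1 x = (x :: 'a::{field,finite})"
  shows "x \<in> range of_nat"
proof -
  let ?p = "CHAR('a)"
  have p: "prime ?p" by (rule prime_CHAR_finite_field)
  define P where "P = monom (1::'a) ?p - monom 1 1"
  have "coeff P ?p = 1"
    using prime_gt_1_nat[OF p] by (simp add: P_def)
  then have nz: "P \<noteq> 0" by auto
  have deg: "degree P \<le> ?p"
    unfolding P_def using prime_gt_0_nat[OF p]
    by (intro degree_diff_le) (auto simp: degree_monom_eq)
  have root: "poly P y = 0 \<longleftrightarrow> frob 1 y = y" for y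
    by (simp add: P_def poly_monom frob_def)
  have inj: "inj_on (of_nat :: nat \<Rightarrow> 'a) {..<?p}"
  proof (rule inj_onI)
    fix i j assume ij: "i \<in> {..<?p}" "j \<in> {..<?p}" "of_nat i = (of_nat j :: 'a)"
    have *: "i \<ge> j \<Longrightarrow> i = j" if "i < ?p" "of_nat i = (of_nat j :: 'a)" for i j
    proof -
      assume "i \<ge> j"
      then have "of_nat (i - j) = (0 :: 'a)" using that by (simp add: of_nat_diff)
      then have "?p dvd i - j" by (simp add: of_nat_eq_0_iff_char_dvd)
      with that(1) \<open>i \<ge> j\<close> show "i = j" by (auto dest: dvd_imp_le)
    qed
    show "i = j" using *[of i j] *[of j i] ij by (metis lessThan_iff nle_le)
  qed
  have sub: "of_nat ` {..<?p} \<subseteq> {y. poly P y = 0}"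
    unfolding root by (auto simp: field_automorphism_of_nat[OF field_automorphism_frob])
  have fin: "finite {y. poly P y = 0}" using nz by (rule poly_roots_finite)
  have "card {y. poly P y = 0} \<le> ?p"
    using card_poly_roots_bound[OF nz] deg by linarith
  then have "of_nat ` {..<?p} = {y. poly P y = 0}"
    using card_seteq[OF fin sub] card_image[OF inj] by simp
  moreover have "x \<in> {y. poly P y = 0}" using assms root by blast
  ultimately show ?thesis by blast
qed

text \<open>Infinitely many exponents share finitely many maps, so two of them agree; cancelling the
  smaller power, which is injective, leaves the identity.\<close>

lemma frob_periodic: "\<exists>k>0. frob k = (id :: 'a::{field,finite} \<Rightarrow> 'a)"
proof -
  have "\<not> inj (frob :: nat \<Rightarrow> 'a \<Rightarrow> 'a)"
    using finite_imageD[of "frob :: nat \<Rightarrow> 'a \<Rightarrow> 'a" UNIV] by auto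
  then obtain i j where "i < j" "frob i = (frob j :: 'a \<Rightarrow> 'a)"
    unfolding inj_def by (metis linorder_neqE_nat)
  then have "frob i \<circ> frob (j - i) = (frob i \<circ> id :: 'a \<Rightarrow> 'a)"
    using frob_add[of i "j - i", where ?'a = 'a] by simp
  moreover have "inj (frob i :: 'a \<Rightarrow> 'a)"
    using field_automorphism_frob by (auto simp: field_automorphism_def bij_def)
  ultimately have "frob (j - i) = (id :: 'a \<Rightarrow> 'a)"
    by (simp add: fun_eq_iff inj_eq)
  with \<open>i < j\<close> show ?thesis by (intro exI[of _ "j - i"]) auto
qed

section \<open>Every automorphism is a Frobenius power\<close>

text \<open>Recasts the type class as the locale \<open>field\<close>, for which the multiplicative
  group of a finite field is known to be cyclic.\<close>

lemma field_of_type_class: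
  "field (\<lparr>carrier = UNIV, monoid.mult = (*), one = 1, ring.zero = 0, add = (+)\<rparr> :: 'a::field ring)"
  (is "field ?R")
proof (rule cring.cring_fieldI2)
  show "cring ?R"
  proof (rule cringI)
    have "\<exists>y. y + x = 0" for x :: 'a
      by (rule exI[of _ "- x"]) simp
    then show "abelian_group ?R"
      by (intro abelian_groupI) (simp_all add: add.assoc add.commute)
    show "Group.comm_monoid ?R"
      by (intro comm_monoidI) (simp_all add: mult.assoc mult.commute)
  qed (simp add: distrib_right)
  fix x :: 'a
  assume "x \<in> carrier ?R" "x \<noteq> \<zero>\<^bsub>?R\<^esub>"
  then show "\<exists>y\<in>carrier ?R. x \<otimes>\<^bsub>?R\<^esub> y = \<one>\<^bsub>?R\<^esub>"
    by (intro bexI[of _ "inverse x"]) simp_all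
qed simp

lemma finite_field_generator:
  "\<exists>g::'a::{field,finite}. \<forall>x. x \<noteq> 0 \<longrightarrow> (\<exists>i::nat. x = g ^ i)"
proof -
  define R :: "'a ring"
    where "R = \<lparr>carrier = UNIV, monoid.mult = (*), one = 1, ring.zero = 0, add = (+)\<rparr>"
  interpret R: field R
    unfolding R_def by (rule field_of_type_class)
  have car: "carrier R = UNIV" and zero: "\<zero>\<^bsub>R\<^esub> = 0"
    by (simp_all add: R_def)
  have pow: "x [^]\<^bsub>R\<^esub> (i::nat) = x ^ i" for x :: 'a and i
    by (induction i) (simp_all add: R_def nat_pow_def mult.commute)
  obtain g where g: "carrier (mult_of R) = {g [^]\<^bsub>R\<^esub> i | i::nat. i \<in> UNIV}"
    using R.finite_field_mult_group_has_gen car by auto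
  have "\<exists>i::nat. x = g ^ i" if "x \<noteq> 0" for x
  proof -
    have "x \<in> carrier (mult_of R)" using that by (simp add: car zero)
    then obtain i :: nat where "x = g [^]\<^bsub>R\<^esub> i"
      using g by auto
    then have "x = g ^ i" by (simp only: pow)
    then show ?thesis by (rule exI)
  qed
  then show ?thesis by (intro exI[of _ g] allI impI)
qed

text \<open>If \<open>g\<close> generates the multiplicative group, the product of \<open>X - g'\<close> over the Frobenius
  orbit of \<open>g\<close> has coefficients in the prime field, so \<open>\<sigma> g\<close> is one of its roots.\<close>

lemma field_automorphism_eq_frob:
  fixes \<sigma> :: "'a::{field,finite} \<Rightarrow> 'a"
  assumes \<sigma>: "field_automorphism \<sigma>"
  shows "\<exists>t. \<sigma> = frob t"
proof -
  obtain g :: 'a where g: "\<And>x. x \<noteq> 0 \<Longrightarrow> \<exists>i::nat. x = g ^ i"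
    using finite_field_generator by blast
  obtain k where k: "k > 0" "frob k = (id :: 'a \<Rightarrow> 'a)"
    using frob_periodic by blast
  define P where "P = (\<Prod>i<k. [:- frob i g, 1:])"
  have F: "field_automorphism (frob 1 :: 'a \<Rightarrow> 'a)" by (rule field_automorphism_frob)
  have lin: "map_poly (frob 1) [:- frob i g, 1:] = [:- frob (Suc i) g, 1:]" for i
  proof -
    have "frob 1 (- c) + frob 1 c = 0" for c :: 'a
      using F field_automorphism_0[OF F] unfolding field_automorphism_def
      by (metis add.left_inverse)
    then have m: "frob 1 (- c) = - frob 1 c" for c :: 'a
      by (simp add: eq_neg_iff_add_eq_0)
    have "frob 1 (frob i g) = frob (Suc i) g"
      using frob_add[of 1 i, where ?'a = 'a] by (simp add: fun_eq_iff)
    then show ?thesis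
      using F field_automorphism_0[OF F] m by (simp add: map_poly_pCons field_automorphism_def)
  qed
  have "map_poly (frob 1) P = (\<Prod>i<k. [:- frob (Suc i) g, 1:])"
    unfolding P_def map_poly_automorphism_prod[OF F] lin ..
  \<comment> \<open>The Frobenius map shifts the factors by one place; the factor gained at
    \<open>k\<close> equals the factor lost at 0, because \<open>frob k = id\<close>.\<close>
  also have "\<dots> = P"
  proof -
    let ?h = "\<lambda>i. [:- frob i g, 1:]"
    have "?h 0 * (\<Prod>i<k. ?h (Suc i)) = (\<Prod>i<Suc k. ?h i)"
      by (rule prod.lessThan_Suc_shift[symmetric])
    also have "\<dots> = (\<Prod>i<k. ?h i) * ?h k" by simp
    also have "?h k = ?h 0" using k by (simp add: frob_0)
    finally have "?h 0 * (\<Prod>i<k. ?h (Suc i)) = ?h 0 * (\<Prod>i<k. ?h i)"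
      by (simp only: mult.commute)
    moreover have "?h 0 \<noteq> 0" by simp
    ultimately show ?thesis
      unfolding P_def by (metis mult_cancel_left)
  qed
  finally have "frob 1 (coeff P i) = coeff P i" for i
    by (metis coeff_map_poly field_automorphism_0[OF F])
  then have "\<sigma> (coeff P i) = coeff P i" for i
    using frob_1_fixed[of "coeff P i"] field_automorphism_of_nat[OF \<sigma>] by auto
  then have "map_poly \<sigma> P = P"
    by (intro poly_eqI) (simp add: coeff_map_poly field_automorphism_0[OF \<sigma>])
  moreover have "poly P g = 0"
    unfolding P_def poly_prod using k(1) by (intro prod_zero bexI[of _ 0]) (auto simp: frob_0)
  ultimately have "poly P (\<sigma> g) = 0"
    using poly_map_poly_automorphism[OF \<sigma>, of P g] field_automorphism_0[OF \<sigma>] by simp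
  then obtain t where t: "\<sigma> g = frob t g"
    unfolding P_def poly_prod by auto
  \<comment> \<open>Automorphisms that agree on the generator \<open>g\<close> agree on its powers,
    that is, on all nonzero elements.\<close>
  have "\<sigma> x = frob t x" for x
  proof (cases "x = 0")
    case True
    then show ?thesis
      using field_automorphism_0[OF \<sigma>] field_automorphism_0[OF field_automorphism_frob] by simp
  next
    case False
    then obtain i where "x = g ^ i" using g by blast
    then show ?thesis
      using t field_automorphism_power[OF \<sigma>] field_automorphism_power[OF field_automorphism_frob]
      by metis
  qed
  then show ?thesis by blast
qed

section \<open>Subgroups of the cyclic automorphism group\<close>

text \<open>\<open>a\<close> is the least positive element, or 0 if there is none; remainders on
  division by it stay in \<open>E\<close>.\<close>

lemma nat_subgroup_multiples:
  fixes E :: "nat set"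
  assumes "0 \<in> E" "\<And>x y. x \<in> E \<Longrightarrow> y \<in> E \<Longrightarrow> x + y \<in> E"
    and "\<And>x y. x \<in> E \<Longrightarrow> y \<in> E \<Longrightarrow> y \<le> x \<Longrightarrow> x - y \<in> E"
  shows "\<exists>a. \<forall>t. t \<in> E \<longleftrightarrow> a dvd t"
proof (cases "E \<subseteq> {0}")
  case True
  then show ?thesis using assms(1) by (intro exI[of _ 0]) auto
next
  case False
  define a where "a = (LEAST x. x \<in> E \<and> x > 0)"
  have a: "a \<in> E \<and> a > 0"
    unfolding a_def by (rule LeastI_ex) (use False in auto)
  have le: "a \<le> x" if "x \<in> E" "x > 0" for x
    unfolding a_def by (rule Least_le) (use that in auto)
  have mult: "a * i \<in> E" for i
    by (induction i) (use a assms in auto)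
  have "a dvd x" if "x \<in> E" for x
  proof -
    have "x - a * (x div a) \<in> E" using assms(3)[OF that mult] by simp
    then have "x mod a \<in> E" by (simp add: minus_mult_div_eq_mod)
    then show ?thesis using le[of "x mod a"] a by (meson dvd_eq_mod_eq_0 leD mod_less_divisor not_gr_zero)
  qed
  then show ?thesis using mult by (intro exI[of _ a]) (auto elim: dvdE)
qed

definition aut_subgroup :: "('a::field \<Rightarrow> 'a) set \<Rightarrow> bool"
  where "aut_subgroup S \<longleftrightarrow> id \<in> S \<and> (\<forall>\<sigma>\<in>S. field_automorphism \<sigma> \<and> inv_into UNIV \<sigma> \<in> S) \<and>
    (\<forall>\<sigma>\<in>S. \<forall>\<tau>\<in>S. \<sigma> \<circ> \<tau> \<in> S)"

text \<open>Since every automorphism is some \<open>frob t\<close>, the number \<open>a\<close>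
  determines \<open>S\<close>, and inclusions between subgroups turn into divisibilities.\<close>

lemma aut_subgroup_exponents:
  fixes S :: "('a::{field,finite} \<Rightarrow> 'a) set"
  assumes "aut_subgroup S"
  shows "\<exists>a. \<forall>t. frob t \<in> S \<longleftrightarrow> a dvd t"
proof -
  have "\<exists>a. \<forall>t. t \<in> {t. frob t \<in> S} \<longleftrightarrow> a dvd t"
  proof (rule nat_subgroup_multiples)
    show "0 \<in> {t. frob t \<in> S}" using assms by (simp add: frob_0 aut_subgroup_def)
    show "x + y \<in> {t. frob t \<in> S}" if "x \<in> {t. frob t \<in> S}" "y \<in> {t. frob t \<in> S}" for x y
      using that assms by (simp add: frob_add aut_subgroup_def)
    fix x y assume xy: "x \<in> {t. frob t \<in> S}" "y \<in> {t. frob t \<in> S}" "y \<le> x"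
    have i: "inj (frob y :: 'a \<Rightarrow> 'a)"
      using field_automorphism_frob by (auto simp: field_automorphism_def bij_def)
    have "frob x = frob y \<circ> (frob (x - y) :: 'a \<Rightarrow> 'a)"
      using xy by (simp flip: frob_add)
    then have "frob (x - y) = inv_into UNIV (frob y) \<circ> (frob x :: 'a \<Rightarrow> 'a)"
      using i by (simp add: fun_eq_iff)
    then show "x - y \<in> {t. frob t \<in> S}"
      using xy assms by (simp add: aut_subgroup_def)
  qed
  then show ?thesis by simp
qed

text \<open>\<open>Aut(F)\<close> is cyclic, so at each prime the subgroups are totally ordered, and one suitable
  subgroup per prime divisor of \<open>|S\<^sub>0|\<close> already cuts out the whole intersection.\<close>

lemma aut_subgroups_Inter:
  fixes S\<^sub>0 S\<^sub>1 :: "('a::{field,finite} \<Rightarrow> 'a) set"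
  assumes "aut_subgroup S\<^sub>0" "aut_subgroup S\<^sub>1" "S\<^sub>1 \<subseteq> S\<^sub>0" "finite N"
    and "\<And>j. j \<in> N \<Longrightarrow> aut_subgroup (S j)"
  shows "\<exists>J\<subseteq>N. card J \<le> card (prime_factors (card S\<^sub>0)) \<and> S\<^sub>1 \<inter> (\<Inter>j\<in>J. S j) \<subseteq> (\<Inter>j\<in>N. S j)"
proof (cases "N = {}")
  case False
  have id_sub: "aut_subgroup {id :: 'a \<Rightarrow> 'a}"
    by (simp add: aut_subgroup_def field_automorphism_id)
  \<comment> \<open>The exponents of the trivial subgroup are the multiples of the order
    \<open>k\<close> of the Frobenius map.\<close>
  obtain k where "\<And>t. frob t \<in> {id :: 'a \<Rightarrow> 'a} \<longleftrightarrow> k dvd t"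
    using aut_subgroup_exponents[OF id_sub] by auto
  then have k: "frob t = (id :: 'a \<Rightarrow> 'a) \<longleftrightarrow> k dvd t" for t
    by simp
  have k0: "k > 0"
  proof -
    obtain t where "t > 0" "frob t = (id :: 'a \<Rightarrow> 'a)"
      using frob_periodic[where ?'a = 'a] by auto
    then have "k dvd t" using k[of t] by simp
    with \<open>t > 0\<close> show ?thesis by (auto intro!: gr0I)
  qed
  obtain d where d: "\<And>t. frob t \<in> S\<^sub>0 \<longleftrightarrow> d dvd t"
    using aut_subgroup_exponents[OF assms(1)] by blast
  have "\<forall>j\<in>N. \<exists>a. \<forall>t. frob t \<in> S j \<longleftrightarrow> a dvd t"
    using aut_subgroup_exponents assms(5) by blast
  then obtain a where a: "\<And>j t. j \<in> N \<Longrightarrow> frob t \<in> S j \<longleftrightarrow> a j dvd t"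
    by metis
  have frob_k: "frob k = (id :: 'a \<Rightarrow> 'a)" using k[of k] by simp
  have ak: "a j dvd k" if "j \<in> N" for j
    using a[OF that, of k] assms(5)[OF that] by (simp add: frob_k aut_subgroup_def)
  have "d dvd k"
    using d[of k] assms(1) by (simp add: frob_k aut_subgroup_def)
  then obtain e where e: "k = d * e" by blast
  with k0 have de: "d > 0" "e > 0" by auto
  \<comment> \<open>\<open>e = k / d\<close> is the order of \<open>S\<^sub>0\<close>: the powers
    \<open>frob (d * i)\<close> with \<open>i < e\<close> are distinct and exhaust it.\<close>
  have inj: "inj_on (\<lambda>i. frob (d * i) :: 'a \<Rightarrow> 'a) {..<e}"
  proof (rule inj_onI)
    have *: "i = j" if "i < e" "j \<le> i" "frob (d * i) = (frob (d * j) :: 'a \<Rightarrow> 'a)" for i j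
    proof -
      have "inj (frob (d * j) :: 'a \<Rightarrow> 'a)"
        using field_automorphism_frob by (auto simp: field_automorphism_def bij_def)
      moreover have "d * j + d * (i - j) = d * i"
        using that(2) by (metis add_mult_distrib2 le_add_diff_inverse)
      then have "frob (d * j) \<circ> frob (d * (i - j)) = (frob (d * j) \<circ> id :: 'a \<Rightarrow> 'a)"
        using that(3) frob_add[of "d * j" "d * (i - j)", where ?'a = 'a] by simp
      ultimately have "frob (d * (i - j)) = (id :: 'a \<Rightarrow> 'a)"
        by (simp add: fun_eq_iff inj_eq)
      then have "d * e dvd d * (i - j)" using k[of "d * (i - j)"] e by simp
      then have "e dvd i - j" using de by simp
      with that show ?thesis by (auto dest: dvd_imp_le)
    qed
    fix i j assume "i \<in> {..<e}" "j \<in> {..<e}" "frob (d * i) = (frob (d * j) :: 'a \<Rightarrow> 'a)"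
    then show "i = j" using *[of i j] *[of j i] by (metis lessThan_iff nle_le)
  qed
  have "S\<^sub>0 = (\<lambda>i. frob (d * i)) ` {..<e}"
  proof
    show "(\<lambda>i. frob (d * i)) ` {..<e} \<subseteq> S\<^sub>0" by (auto simp: d)
    show "S\<^sub>0 \<subseteq> (\<lambda>i. frob (d * i)) ` {..<e}"
    proof
      fix \<sigma> assume "\<sigma> \<in> S\<^sub>0"
      then obtain t where t: "\<sigma> = frob t"
        using assms(1) field_automorphism_eq_frob[of \<sigma>] by (auto simp: aut_subgroup_def)
      with \<open>\<sigma> \<in> S\<^sub>0\<close> obtain i where i: "t = d * i" using d[of t] by (auto elim: dvdE)
      have "t = d * (i mod e) + k * (i div e)"
        unfolding i e by (metis add_mult_distrib2 add.commute mult.assoc mult_div_mod_eq)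
      moreover have "frob (k * (i div e)) = (id :: 'a \<Rightarrow> 'a)" using k[of "k * (i div e)"] by simp
      ultimately have "\<sigma> = frob (d * (i mod e))" using t by (simp add: frob_add)
      then show "\<sigma> \<in> (\<lambda>i. frob (d * i)) ` {..<e}" using de by auto
    qed
  qed
  then have card: "card S\<^sub>0 = e" using card_image[OF inj] by simp
  \<comment> \<open>\<open>c p\<close> selects a subgroup whose exponent has the largest
    \<open>p\<close>-part among all \<open>a i\<close>, that is, the most restrictive one at
    \<open>p\<close>.\<close>
  define c where "c p = (SOME j. j \<in> N \<and> (\<forall>i\<in>N. multiplicity p (a i) \<le> multiplicity p (a j)))" for p
  have c: "c p \<in> N \<and> (\<forall>i\<in>N. multiplicity p (a i) \<le> multiplicity p (a (c p)))" for p
  proof -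
    have "\<exists>j\<in>N. \<forall>i\<in>N. multiplicity p (a i) \<le> multiplicity p (a j)"
    proof -
      let ?M = "(\<lambda>j. multiplicity p (a j)) ` N"
      have "Max ?M \<in> ?M" using False \<open>finite N\<close> by (intro Max_in) auto
      then obtain j where j: "j \<in> N" "Max ?M = multiplicity p (a j)" by auto
      have "multiplicity p (a i) \<le> multiplicity p (a j)" if "i \<in> N" for i
        unfolding j(2)[symmetric] using that \<open>finite N\<close> by (intro Max_ge) auto
      with j(1) show ?thesis by (intro bexI[of _ j] ballI)
    qed
    then show ?thesis
      unfolding c_def Bex_def by (rule someI_ex)
  qed
  let ?J = "c ` prime_factors e"
  have "\<sigma> \<in> S j" if \<sigma>: "\<sigma> \<in> S\<^sub>1" "\<And>i. i \<in> ?J \<Longrightarrow> \<sigma> \<in> S i" and j: "j \<in> N" for \<sigma> j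
  proof -
    obtain t where t: "\<sigma> = frob t"
      using \<sigma>(1) assms(2) field_automorphism_eq_frob[of \<sigma>] by (auto simp: aut_subgroup_def)
    have "a j dvd t"
    proof (cases "t = 0")
      case t0: False
      have dt: "d dvd t" using d[of t] t \<sigma>(1) assms(3) by auto
      have aj: "a j \<noteq> 0" using ak[OF j] k0 by auto
      show ?thesis
      proof (rule multiplicity_le_imp_dvd[OF aj])
        fix p :: nat assume p: "prime p"
        show "multiplicity p (a j) \<le> multiplicity p t"
        proof (cases "p dvd e")
          case True
          then have "p \<in> prime_factors e" using p de by (simp add: in_prime_factors_iff)
          then have "a (c p) dvd t" using \<sigma>(2)[of "c p"] a[of "c p" t] c[of p] t by simp
          then have "multiplicity p (a (c p)) \<le> multiplicity p t"
            using t0 by (intro dvd_imp_multiplicity_le) auto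
          then show ?thesis using c[of p] j by (meson le_trans)
        next
          case False
          \<comment> \<open>Away from the divisors of \<open>e\<close>, the numbers \<open>k\<close>
            and \<open>d\<close> have the same \<open>p\<close>-part, so \<open>a j dvd k\<close>
            and \<open>d dvd t\<close> settle the prime \<open>p\<close>.\<close>
          have "multiplicity p (a j) \<le> multiplicity p k"
            using ak[OF j] k0 by (intro dvd_imp_multiplicity_le) auto
          also have "\<dots> = multiplicity p d"
            unfolding e using p de False
            by (subst prime_elem_multiplicity_mult_distrib) (auto simp: not_dvd_imp_multiplicity_0)
          also have "\<dots> \<le> multiplicity p t"
            using dt t0 by (intro dvd_imp_multiplicity_le) auto
          finally show ?thesis .
        qed
      qed
    qed simp
    then show ?thesis using a[OF j, of t] t by simp
  qed
  moreover have "card ?J \<le> card (prime_factors (card S\<^sub>0))"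
    unfolding card by (rule card_image_le) simp
  moreover have "?J \<subseteq> N" using c by auto
  ultimately show ?thesis by (intro exI[of _ ?J] conjI subsetI INT_I) auto
qed auto

section \<open>Pointwise stabilisers in the general linear group\<close>

lemma two_le_CARD_field: "2 \<le> CARD('a::{field,finite})"
  using card_mono[of UNIV "{0, 1 :: 'a}"] by simp

text \<open>When \<open>x\<close> is adjoined to the basis, \<open>(c, v) \<mapsto> c x + v\<close>
  is a bijection from scalars times the old span onto the new one.\<close>

lemma card_span:
  fixes B :: "('a::{field,finite} ^ 'n) set"
  assumes "finite B" "vec.independent B"
  shows "card (vec.span B) = CARD('a) ^ card B"
  using assms
proof (induction B)
  case (insert x B)
  have x: "x \<notin> vec.span B" and B: "vec.independent B"
    using insert.prems insert.hyps by (auto simp: vec.independent_insert)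
  let ?f = "\<lambda>(c, v). c *s x + v"
  have "inj_on ?f (UNIV \<times> vec.span B)"
  proof (rule inj_onI, clarify)
    fix c d v w
    assume vw: "v \<in> vec.span B" "w \<in> vec.span B" and eq: "c *s x + v = d *s x + w"
    have "c = d"
    proof (rule ccontr)
      assume "c \<noteq> d"
      have "(c - d) *s x = w - v"
        using eq by (simp add: vec.scale_left_diff_distrib algebra_simps)
      then have "(c - d) *s x \<in> vec.span B"
        using vw by (simp add: vec.span_diff)
      then have "inverse (c - d) *s ((c - d) *s x) \<in> vec.span B"
        by (rule vec.span_scale)
      with x \<open>c \<noteq> d\<close> show False by simp
    qed
    with eq show "c = d \<and> v = w" by simp
  qed
  moreover have "?f ` (UNIV \<times> vec.span B) = vec.span (insert x B)"
  proof
    show "?f ` (UNIV \<times> vec.span B) \<subseteq> vec.span (insert x B)"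
    proof clarify
      fix c v assume "v \<in> vec.span B"
      then show "c *s x + v \<in> vec.span (insert x B)"
        unfolding vec.span_insert by (auto intro!: exI[of _ c])
    qed
    show "vec.span (insert x B) \<subseteq> ?f ` (UNIV \<times> vec.span B)"
    proof
      fix v assume "v \<in> vec.span (insert x B)"
      then obtain k where "v - k *s x \<in> vec.span B" by (auto simp: vec.span_insert)
      then show "v \<in> ?f ` (UNIV \<times> vec.span B)"
        by (intro image_eqI[of _ _ "(k, v - k *s x)"]) auto
    qed
  qed
  ultimately have "card (vec.span (insert x B)) = card ((UNIV :: 'a set) \<times> vec.span B)"
    by (metis card_image)
  then show ?case
    using insert.IH[OF B] insert.hyps by (simp add: card_cartesian_product)
qed simp

lemma card_subspace:
  fixes U :: "('a::{field,finite} ^ 'n) set"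
  assumes "vec.subspace U"
  shows "card U = CARD('a) ^ vec.dim U"
proof -
  obtain B where B: "B \<subseteq> U" "vec.independent B" "U \<subseteq> vec.span B" "card B = vec.dim U"
    using vec.basis_exists by blast
  have "vec.span B = U" using B assms by (simp add: subset_antisym vec.span_minimal)
  then show ?thesis using card_span[OF _ B(2)] B(4) by simp
qed

text \<open>For \<open>g\<close> in \<open>A\<close> but not in \<open>A'\<close>, the translates of
  \<open>A'\<close> by multiples of \<open>g\<close> are pairwise disjoint subsets of
  \<open>A\<close>. Cardinalities thus stand in for dimensions of spaces of maps.\<close>

lemma card_function_space_psubset:
  fixes A A' :: "('b::finite \<Rightarrow> 'a::{field,finite} ^ 'n) set"
  assumes "A' \<subset> A"
    and A: "\<And>c g h. g \<in> A \<Longrightarrow> h \<in> A \<Longrightarrow> (\<lambda>x. c *s g x + h x) \<in> A"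
    and A': "\<And>c g h. g \<in> A' \<Longrightarrow> h \<in> A' \<Longrightarrow> (\<lambda>x. c *s g x + h x) \<in> A'"
  shows "CARD('a) * card A' \<le> card A"
proof -
  obtain g where g: "g \<in> A" "g \<notin> A'" using assms(1) by blast
  let ?f = "\<lambda>(c :: 'a, h). \<lambda>x. c *s g x + h x"
  have diff: "(\<lambda>x. c *s (h x - h' x)) \<in> A'" if h: "h \<in> A'" "h' \<in> A'" for c h h'
  proof -
    \<comment> \<open>\<open>- h + h\<close> supplies the zero function, from which the closure rule
      builds \<open>c (h - h')\<close>.\<close>
    have "(\<lambda>x. (- 1) *s h x + h x) \<in> A'" using h by (intro A')
    then have "(\<lambda>x. (- c) *s h' x + ((- 1) *s h x + h x)) \<in> A'" by (rule A'[OF h(2)])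
    then have "(\<lambda>x. c *s h x + ((- c) *s h' x + ((- 1) *s h x + h x))) \<in> A'" by (rule A'[OF h(1)])
    then show ?thesis by (simp add: vec.scale_right_diff_distrib)
  qed
  have "inj_on ?f (UNIV \<times> A')"
  proof (rule inj_onI, clarify)
    fix c d h h'
    assume h: "h \<in> A'" "h' \<in> A'" and eq: "(\<lambda>x. c *s g x + h x) = (\<lambda>x. d *s g x + h' x)"
    have "c = d"
    proof (rule ccontr)
      assume "c \<noteq> d"
      have "(c - d) *s g x = h' x - h x" for x
        using fun_cong[OF eq, of x] by (simp add: vec.scale_left_diff_distrib algebra_simps)
      then have "inverse (c - d) *s (h' x - h x) = inverse (c - d) *s ((c - d) *s g x)" for x
        by simp
      then have "g = (\<lambda>x. inverse (c - d) *s (h' x - h x))"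
        using \<open>c \<noteq> d\<close> by (simp add: fun_eq_iff)
      with diff[OF h(2,1)] g(2) show False by simp
    qed
    with eq show "c = d \<and> h = h'" by (simp add: fun_eq_iff)
  qed
  moreover have "?f ` (UNIV \<times> A') \<subseteq> A"
    using A g(1) assms(1) by auto
  ultimately have "card ((UNIV :: 'a set) \<times> A') \<le> card A"
    by (intro card_inj_on_le) auto
  then show ?thesis by (simp add: card_cartesian_product)
qed

text \<open>Restriction to \<open>B\<close> embeds \<open>A\<close> into the product of the
  \<open>T b\<close>. It is applied with \<open>B\<close> a basis and \<open>T b\<close> an
  invariant subspace containing \<open>b\<close>.\<close>

lemma card_functions_le:
  fixes A :: "('b::finite \<Rightarrow> 'c::finite) set"
  assumes "\<And>g b. g \<in> A \<Longrightarrow> b \<in> B \<Longrightarrow> g b \<in> T b"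
    and "\<And>g h. g \<in> A \<Longrightarrow> h \<in> A \<Longrightarrow> (\<And>b. b \<in> B \<Longrightarrow> g b = h b) \<Longrightarrow> g = h"
  shows "card A \<le> (\<Prod>b\<in>B. card (T b))"
proof -
  have "inj_on (\<lambda>g. restrict g B) A"
  proof (rule inj_onI)
    fix g h assume gh: "g \<in> A" "h \<in> A" and eq: "restrict g B = restrict h B"
    have "g b = h b" if "b \<in> B" for b
      using fun_cong[OF eq, of b] that by simp
    with gh show "g = h" by (rule assms(2))
  qed
  moreover have "(\<lambda>g. restrict g B) ` A \<subseteq> PiE B T"
    using assms(1) by auto
  ultimately have "card A \<le> card (PiE B T)"
    by (intro card_inj_on_le) (auto intro: finite_PiE)
  then show ?thesis by (simp add: card_PiE)
qed

text \<open>\<open>c\<close> is a positive weight that every useful insertion divides by at least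
  \<open>q\<close>; strict decrease ends the process, and the final inequality bounds the number of
  inserted elements by a logarithm of the initial weight.\<close>

lemma greedy_extension:
  fixes c :: "'i set \<Rightarrow> nat"
  assumes "q \<ge> 2" and pos: "\<And>I. I \<subseteq> N \<Longrightarrow> c I > 0"
    and step: "\<And>I. I0 \<subseteq> I \<Longrightarrow> I \<subseteq> N \<Longrightarrow> \<not> good I \<Longrightarrow> \<exists>j\<in>N. q * c (insert j I) \<le> c I"
    and "I0 \<subseteq> N" "finite N"
  shows "\<exists>I. I0 \<subseteq> I \<and> I \<subseteq> N \<and> good I \<and> q ^ (card I - card I0) * c I \<le> c I0"
proof -
  have "\<exists>I. I1 \<subseteq> I \<and> I \<subseteq> N \<and> good I \<and> q ^ (card I - card I1) * c I \<le> c I1"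
    if "I0 \<subseteq> I1" "I1 \<subseteq> N" for I1
    using that
  proof (induction "c I1" arbitrary: I1 rule: less_induct)
    case less
    show ?case
    proof (cases "good I1")
      case True
      then show ?thesis using less.prems by (intro exI[of _ I1]) simp
    next
      case False
      then obtain j where j: "j \<in> N" "q * c (insert j I1) \<le> c I1"
        using step less.prems by blast
      have ins: "insert j I1 \<subseteq> N" "I0 \<subseteq> insert j I1" using j less.prems by auto
      have "2 * c (insert j I1) \<le> c I1"
        using j(2) assms(1) by (meson le_trans mult_le_mono1)
      then have "c (insert j I1) < c I1" using pos[OF ins(1)] by linarith
      then obtain I where I: "insert j I1 \<subseteq> I" "I \<subseteq> N" "good I"
        "q ^ (card I - card (insert j I1)) * c I \<le> c (insert j I1)"
        using less.hyps[OF _ ins(2,1)] by blast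
      have "card I - card I1 \<le> Suc (card I - card (insert j I1))"
        using finite_subset[OF less.prems(2) assms(5)] by (cases "j \<in> I1") (simp_all add: insert_absorb)
      then have "q ^ (card I - card I1) \<le> q ^ Suc (card I - card (insert j I1))"
        using assms(1) by (intro power_increasing) auto
      then have "q ^ (card I - card I1) * c I \<le> q * (q ^ (card I - card (insert j I1)) * c I)"
        by simp
      also have "\<dots> \<le> q * c (insert j I1)" using I(4) by simp
      also have "\<dots> \<le> c I1" by (rule j(2))
      finally show ?thesis using I by blast
    qed
  qed
  from this[OF subset_refl assms(4)] show ?thesis .
qed

section \<open>A small base for linear stabilisers\<close>

text \<open>For a family with two distinct members, the greedy stages give
  \<open>|I| + 2m \<le> (s + d + 2) + (d^2 + m(s - d) - 1)\<close>, where \<open>s\<close> is the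
  dimension of the span and \<open>d < m\<close> that of the intersection of the two members;
  \<open>d(d + 1) \<le> md\<close> and \<open>s \<le> n\<close> then yield the bound.\<close>

lemma GL_stabilizer_base:
  fixes X :: "'i \<Rightarrow> ('a::{field,finite} ^ 'n) set"
  assumes N: "finite N" "N \<noteq> {}" and m: "m \<ge> 1"
    and X: "\<And>i. i \<in> N \<Longrightarrow> X i \<in> subspaces_of_dim m"
  shows "\<exists>I\<subseteq>N. card I + 2 * m \<le> (m + 1) * CARD('n) + 1 \<and>
    (\<forall>f\<in>GL. (\<forall>i\<in>I. f ` X i = X i) \<longrightarrow> (\<forall>i\<in>N. f ` X i = X i))"
proof (cases "\<exists>i\<in>N. \<exists>j\<in>N. X i \<noteq> X j")
  case False
  obtain i where i: "i \<in> N" using N by blast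
  have "vec.dim (X i) = m" using X[OF i] by (simp add: subspaces_of_dim_def)
  then have "m \<le> CARD('n)"
    using dim_subset_UNIV_cart_gen[of "X i"] by simp
  then have "2 * m \<le> (m + 1) * CARD('n)"
    using m by (intro mult_le_mono) auto
  then have "card {i} + 2 * m \<le> (m + 1) * CARD('n) + 1" by simp
  moreover have "X k = X i" if "k \<in> N" for k using False i that by metis
  then have "\<forall>f\<in>GL. (\<forall>k\<in>{i}. f ` X k = X k) \<longrightarrow> (\<forall>k\<in>N. f ` X k = X k)" by simp
  ultimately show ?thesis using i by (intro exI[of _ "{i}"]) simp
next
  case True
  then obtain i j where ij: "i \<in> N" "j \<in> N" "X i \<noteq> X j" by blast
  let ?q = "CARD('a)"
  have q: "?q \<ge> 2" by (rule two_le_CARD_field)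
  have sub: "vec.subspace (X k)" and dim: "vec.dim (X k) = m" if "k \<in> N" for k
    using X[OF that] by (auto simp: subspaces_of_dim_def)
  define U where "U I = vec.span (\<Union>k\<in>I. X k)" for I
  define s where "s = vec.dim (U N)"
  define D where "D = X i \<inter> X j"
  define d where "d = vec.dim D"
  have D: "vec.subspace D" using sub ij by (simp add: D_def vec.subspace_inter)
  have "d < m"
  proof (rule ccontr)
    assume "\<not> d < m"
    then have "m \<le> vec.dim D" by (simp add: d_def)
    moreover have "D \<subseteq> X i" "D \<subseteq> X j" by (auto simp: D_def)
    ultimately have "D = X i" "D = X j"
      using ij dim by (simp_all add: vec.subspace_dim_equal D sub)
    with ij show False by simp
  qed
  have Usub: "U I \<subseteq> U N" if "I \<subseteq> N" for I
    unfolding U_def using that by (intro vec.span_mono) auto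
  have dimU: "vec.dim (U I) \<le> s" if "I \<subseteq> N" for I
    unfolding s_def using Usub[OF that] by (rule vec.dim_subset)
  have XU: "X k \<subseteq> U I" if "k \<in> I" for k I
    unfolding U_def using that by (auto intro: vec.span_base)
  have spanX: "vec.span (X k) = X k" if "k \<in> N" for k
    using sub[OF that] by simp
  have U2: "vec.dim (U {i, j}) + d = 2 * m"
  proof -
    have "U {i, j} = {x + y |x y. x \<in> X i \<and> y \<in> X j}"
      by (simp add: U_def vec.span_Un spanX[OF ij(1)] spanX[OF ij(2)])
    then show ?thesis
      using vec.dim_sums_Int[OF sub sub, of i j] dim ij by (simp add: d_def D_def)
  qed
  \<comment> \<open>With \<open>2 ^ (s - dim)\<close> as weight, each strict enlargement of the span
    at least halves it, so the number of insertions is at most the codimension of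
    \<open>U {i, j}\<close> in \<open>U N\<close>.\<close>
  have "\<exists>I. {i, j} \<subseteq> I \<and> I \<subseteq> N \<and> U I = U N \<and>
      2 ^ (card I - card {i, j}) * 2 ^ (s - vec.dim (U I)) \<le> (2 ^ (s - vec.dim (U {i, j})) :: nat)"
  proof (rule greedy_extension)
    fix I assume I: "I \<subseteq> N" "U I \<noteq> U N"
    have "\<not> (\<forall>k\<in>N. X k \<subseteq> U I)"
    proof
      assume "\<forall>k\<in>N. X k \<subseteq> U I"
      then have "U N \<subseteq> U I"
        unfolding U_def by (intro vec.span_minimal) auto
      with I Usub[OF I(1)] show False by simp
    qed
    then obtain k where k: "k \<in> N" "\<not> X k \<subseteq> U I" by blast
    have "U I \<subseteq> U (insert k I)" unfolding U_def by (intro vec.span_mono) auto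
    moreover have "X k \<subseteq> U (insert k I)" by (rule XU) simp
    ultimately have "U I \<subset> U (insert k I)" using k by blast
    then have "vec.dim (U I) < vec.dim (U (insert k I))"
      by (metis U_def vec.dim_psubset vec.span_span)
    moreover have "vec.dim (U (insert k I)) \<le> s" using I k by (intro dimU) auto
    ultimately have "Suc (s - vec.dim (U (insert k I))) \<le> s - vec.dim (U I)" by linarith
    then have "2 ^ Suc (s - vec.dim (U (insert k I))) \<le> (2 ^ (s - vec.dim (U I)) :: nat)"
      by (intro power_increasing) auto
    with k(1) show "\<exists>k\<in>N. 2 * 2 ^ (s - vec.dim (U (insert k I))) \<le> (2 ^ (s - vec.dim (U I)) :: nat)"
      by auto
  qed (use ij N in auto)
  then obtain I1 where I1: "{i, j} \<subseteq> I1" "I1 \<subseteq> N" "U I1 = U N"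
    "2 ^ (card I1 - card {i, j}) * 2 ^ (s - vec.dim (U I1)) \<le> (2 ^ (s - vec.dim (U {i, j})) :: nat)"
    by blast
  have "(2::nat) ^ (card I1 - 2) \<le> 2 ^ (s - vec.dim (U {i, j}))"
    using I1(3,4) ij by (cases "i = j") (simp_all add: s_def)
  then have "card I1 - 2 \<le> s - vec.dim (U {i, j})"
    by (rule power_le_imp_le_exp[rotated]) simp
  then have cI1: "card I1 + 2 * m \<le> s + d + 2" and sm: "2 * m \<le> s + d"
    using U2 dimU[of "{i, j}"] ij by auto
  obtain B0 where B0: "B0 \<subseteq> D" "vec.independent B0" "D \<subseteq> vec.span B0" "card B0 = d"
    unfolding d_def using vec.basis_exists by blast
  have "B0 \<subseteq> (\<Union>k\<in>I1. X k)" using B0(1) I1(1) by (auto simp: D_def)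
  \<comment> \<open>Extending a basis of \<open>D\<close> by vectors from the chosen subspaces gives
    a basis each of whose members lies in a known invariant subspace.\<close>
  then obtain B where B: "B0 \<subseteq> B" "B \<subseteq> (\<Union>k\<in>I1. X k)" "vec.independent B"
    "(\<Union>k\<in>I1. X k) \<subseteq> vec.span B"
    using vec.maximal_independent_subset_extend[OF _ B0(2)] by metis
  have spanB: "vec.span B = U N"
    unfolding I1(3)[symmetric] using B(2,4)
    by (metis U_def subset_antisym vec.span_minimal vec.span_mono vec.subspace_span)
  have cB: "card B = s"
    unfolding s_def spanB[symmetric] using B(3) by (simp add: vec.dim_eq_card_independent)
  have finB: "finite B" using B(3) by (rule vec.finiteI_independent)
  obtain \<pi> where \<pi>: "range \<pi> \<subseteq> U N" "Vector_Spaces.linear (*s) (*s) \<pi>" "\<And>v. v \<in> U N \<Longrightarrow> \<pi> v = v"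
    using vec.linear_exists_left_inverse_on[OF vec.linear_id, of "U N"]
    by (auto simp: U_def)
  \<comment> \<open>A linear map on \<open>U N\<close> is represented by its extension along the
    projection \<open>\<pi>\<close>, which gives one representative per restriction.\<close>
  define A where "A I = {g. Vector_Spaces.linear (*s) (*s) g \<and> g \<circ> \<pi> = g \<and> (\<forall>k\<in>I. g ` X k \<subseteq> X k)}" for I
  have Acl: "(\<lambda>v. c *s g v + h v) \<in> A I" if "g \<in> A I" "h \<in> A I" "I \<subseteq> N" for I c g h
  proof -
    have "Vector_Spaces.linear (*s) (*s) (\<lambda>v. c *s g v + h v)"
      using that by (intro vec.linear_compose_add vec.linear_compose_scale_right) (auto simp: A_def)
    moreover have "c *s g v + h v \<in> X k" if "k \<in> I" "v \<in> X k" for k v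
    proof -
      have "g ` X k \<subseteq> X k" "h ` X k \<subseteq> X k"
        using \<open>k \<in> I\<close> \<open>g \<in> A I\<close> \<open>h \<in> A I\<close> by (simp_all add: A_def)
      then have "g v \<in> X k" "h v \<in> X k" using \<open>v \<in> X k\<close> by (simp_all add: image_subset_iff)
      then show ?thesis
        using sub[of k] that \<open>I \<subseteq> N\<close> by (auto intro!: vec.subspace_add vec.subspace_scale)
    qed
    moreover have "(\<lambda>v. c *s g v + h v) \<circ> \<pi> = (\<lambda>v. c *s g v + h v)"
      using that by (auto simp: A_def fun_eq_iff)
    ultimately show ?thesis by (auto simp: A_def)
  qed
  have A_scal: "(\<lambda>v. c *s \<pi> v) \<in> A I" if "I \<subseteq> N" for c I
  proof -
    have "\<pi> v = v" if "v \<in> X k" "k \<in> N" for v k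
      using \<pi>(3) XU[OF that(2)] that(1) by blast
    then have "c *s \<pi> v \<in> X k" if "v \<in> X k" "k \<in> N" for v k
      using that sub by (simp add: vec.subspace_scale)
    moreover have "\<pi> (\<pi> v) = \<pi> v" for v using \<pi>(1,3) by blast
    moreover have "Vector_Spaces.linear (*s) (*s) (\<lambda>v. c *s \<pi> v)"
      using \<pi>(2) by (rule vec.linear_compose_scale_right)
    ultimately show ?thesis using that by (auto simp: A_def fun_eq_iff)
  qed
  have Apos: "card (A I) > 0" if "I \<subseteq> N" for I
    using A_scal[OF that] by (auto simp: card_gt_0_iff)
  have "\<exists>I. I1 \<subseteq> I \<and> I \<subseteq> N \<and> A I \<subseteq> A N \<and> ?q ^ (card I - card I1) * card (A I) \<le> card (A I1)"
  proof (rule greedy_extension[OF q Apos])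
    fix I assume I: "I \<subseteq> N" "\<not> A I \<subseteq> A N"
    then obtain g where g: "g \<in> A I" "g \<notin> A N" by blast
    then obtain k where k: "k \<in> N" "\<not> g ` X k \<subseteq> X k" by (auto simp: A_def)
    then have "g \<notin> A (insert k I)" by (auto simp: A_def)
    moreover have "A (insert k I) \<subseteq> A I" by (auto simp: A_def)
    ultimately have "A (insert k I) \<subset> A I" using g(1) by blast
    then have "?q * card (A (insert k I)) \<le> card (A I)"
      by (rule card_function_space_psubset) (use Acl I k in auto)
    with k(1) show "\<exists>k\<in>N. ?q * card (A (insert k I)) \<le> card (A I)" by blast
  qed (use I1 N in auto)
  then obtain I2 where I2: "I1 \<subseteq> I2" "I2 \<subseteq> N" "A I2 \<subseteq> A N"
    "?q ^ (card I2 - card I1) * card (A I2) \<le> card (A I1)"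
    by blast
  \<comment> \<open>The \<open>q\<close> scalar multiples of \<open>\<pi>\<close> survive every
    condition, which saves one entry in the count.\<close>
  have qA: "?q \<le> card (A I2)"
  proof -
    have "\<exists>v\<in>X i. v \<noteq> 0"
    proof (rule ccontr)
      assume "\<not> (\<exists>v\<in>X i. v \<noteq> 0)"
      then have "vec.dim (X i) \<le> vec.dim {0 :: 'a ^ 'n}"
        by (intro vec.dim_subset) auto
      then show False using dim ij m by simp
    qed
    then obtain v where v: "v \<in> X i" "v \<noteq> 0" by blast
    then have "\<pi> v = v" using \<pi>(3) XU[OF ij(1)] by blast
    have "inj (\<lambda>c v. c *s \<pi> v)"
    proof (rule injI)
      fix c d assume "(\<lambda>v. c *s \<pi> v) = (\<lambda>v. d *s \<pi> v)"
      then have "c *s \<pi> v = d *s \<pi> v" by (rule fun_cong)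
      then show "c = d" using v(2) \<open>\<pi> v = v\<close> by simp
    qed
    then show ?thesis
      using A_scal[OF I2(2)] by (intro card_inj_on_le[of "\<lambda>c v. c *s \<pi> v"]) auto
  qed
  \<comment> \<open>\<open>D\<close> is the intersection of two invariant subspaces, so
    \<open>g\<close> maps \<open>B0\<close> into it; each of the \<open>d\<close> vectors of
    \<open>B0\<close> then contributes a factor \<open>q ^ d\<close> instead of
    \<open>q ^ m\<close>.\<close>
  define T where "T b = (if b \<in> B0 then D else X (SOME k. k \<in> I1 \<and> b \<in> X k))" for b
  have T: "(b \<in> B0 \<and> T b = D) \<or> (b \<notin> B0 \<and> (\<exists>k\<in>I1. b \<in> X k \<and> T b = X k))" if "b \<in> B" for b
  proof -
    have "\<exists>k. k \<in> I1 \<and> b \<in> X k" using that B(2) by blast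
    from someI_ex[OF this] show ?thesis unfolding T_def by auto
  qed
  have "card (A I1) \<le> (\<Prod>b\<in>B. card (T b))"
  proof (rule card_functions_le)
    fix g b assume g: "g \<in> A I1" and "b \<in> B"
    have gX: "g v \<in> X k" if "k \<in> I1" "v \<in> X k" for k v
      using that g by (auto simp: A_def)
    then have gD: "g v \<in> D" if "v \<in> D" for v
      using that I1(1) by (auto simp: D_def)
    from T[OF \<open>b \<in> B\<close>] show "g b \<in> T b"
      using gX gD B0(1) by auto
  next
    fix g h assume gh: "g \<in> A I1" "h \<in> A I1" and eq: "\<And>b. b \<in> B \<Longrightarrow> g b = h b"
    have "g v = h v" if "v \<in> vec.span B" for v
      using vec.linear_eq_on[of g h v B] gh eq that by (auto simp: A_def)
    then have "g (\<pi> v) = h (\<pi> v)" for v using \<pi>(1) spanB by blast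
    moreover have "g (\<pi> v) = g v" "h (\<pi> v) = h v" for v
      using gh by (auto simp: A_def fun_eq_iff)
    ultimately show "g = h" by (simp add: fun_eq_iff)
  qed
  also have "\<dots> = (\<Prod>b\<in>B. if b \<in> B0 then ?q ^ d else ?q ^ m)"
  proof (rule prod.cong)
    fix b assume "b \<in> B"
    then show "card (T b) = (if b \<in> B0 then ?q ^ d else ?q ^ m)"
      using T[of b] D sub dim I1(2) by (auto simp: card_subspace d_def subset_iff)
  qed simp
  also have "\<dots> = ?q ^ (d * d + m * (s - d))"
  proof -
    have "card (B - B0) = s - d"
      using B(1) finB B0(4) cB by (simp add: card_Diff_subset finite_subset)
    moreover have "B \<inter> {b. b \<in> B0} = B0" "B \<inter> - {b. b \<in> B0} = B - B0" using B(1) by auto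
    ultimately show ?thesis
      using finB B0(4) by (simp add: prod.If_cases power_add power_mult)
  qed
  finally have "?q ^ (card I2 - card I1) * ?q \<le> ?q ^ (d * d + m * (s - d))"
    using I2(4) qA by (meson le_trans mult_le_mono2)
  then have "?q ^ (Suc (card I2 - card I1)) \<le> ?q ^ (d * d + m * (s - d))"
    by (simp add: mult.commute)
  then have exp: "Suc (card I2 - card I1) \<le> d * d + m * (s - d)"
    by (rule power_le_imp_le_exp[rotated]) (use q in simp)
  have "s \<le> CARD('n)"
    unfolding s_def by (rule dim_subset_UNIV_cart_gen)
  \<comment> \<open>As \<open>d + 1 \<le> m\<close>, the bound for general \<open>d\<close> is no
    larger than that for \<open>d = 0\<close>.\<close>
  have "d * (d + 1) \<le> m * d"
    using mult_le_mono2[of "d + 1" m d] \<open>d < m\<close> by (simp add: mult.commute)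
  moreover have "m * s = m * d + m * (s - d)"
    using sm \<open>d < m\<close> by (simp flip: distrib_left)
  ultimately have "card I2 + 2 * m \<le> (m + 1) * s + 1"
    using exp cI1 by simp
  also have "\<dots> \<le> (m + 1) * CARD('n) + 1"
    using \<open>s \<le> CARD('n)\<close> by (intro add_right_mono mult_left_mono) auto
  finally have "card I2 + 2 * m \<le> (m + 1) * CARD('n) + 1" .
  moreover have "f ` X k = X k" if f: "f \<in> GL" "\<And>k. k \<in> I2 \<Longrightarrow> f ` X k = X k" and k: "k \<in> N" for f k
  proof -
    have \<pi>X: "\<pi> v = v" if "v \<in> X k" "k \<in> N" for v k
      using \<pi>(3) XU[OF that(2)] that(1) by blast
    have f\<pi>: "(f \<circ> \<pi>) ` X k = f ` X k" if "k \<in> N" for k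
      using \<pi>X[OF _ that] by (intro image_cong) auto
    \<comment> \<open>\<open>f\<close> and \<open>f \<circ> \<pi>\<close> agree on every
      \<open>X k\<close>, so \<open>A I2 \<subseteq> A N\<close> applies; inclusions then become
      equalities because \<open>f\<close> is injective and the spaces are finite.\<close>
    have "f \<circ> \<pi> \<in> A I2"
    proof -
      have "Vector_Spaces.linear (*s) (*s) (f \<circ> \<pi>)"
        using f(1) \<pi>(2) by (auto simp: GL_def intro: Vector_Spaces.linear_compose)
      moreover have "\<pi> (\<pi> v) = \<pi> v" for v using \<pi>(1,3) by blast
      moreover have "(f \<circ> \<pi>) ` X k \<subseteq> X k" if "k \<in> I2" for k
        using f\<pi>[of k] f(2)[OF that] I2(2) that by blast
      ultimately show ?thesis by (auto simp: A_def fun_eq_iff)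
    qed
    then have "f \<circ> \<pi> \<in> A N" using I2(3) by blast
    then have "f ` X k \<subseteq> X k" using f\<pi>[OF k] k by (auto simp: A_def)
    moreover have "card (f ` X k) = card (X k)"
      using f(1) by (intro card_image) (auto simp: GL_def bij_def intro: inj_on_subset)
    ultimately show ?thesis by (intro card_seteq) auto
  qed
  ultimately show ?thesis using I2(2) by (intro exI[of _ I2]) auto
qed

section \<open>The lower bound\<close>

text \<open>For \<open>i \<noteq> j\<close>, the elementary transvection sending
  \<open>axis i 1\<close> to \<open>axis i 1 + c axis j 1\<close> and fixing the other axes.\<close>

definition shear :: "'a::field \<Rightarrow> 'n \<Rightarrow> 'n \<Rightarrow> 'a ^ 'n \<Rightarrow> 'a ^ 'n"
  where "shear c i j v = (\<chi> k. if k = j then v $ j + c * v $ i else v $ k)"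

lemma shear_inverse:
  assumes "i \<noteq> j"
  shows "shear (- c) i j (shear c i j v) = v" "shear c i j (shear (- c) i j v) = v"
  using assms by (simp_all add: shear_def vec_eq_iff)

text \<open>The matrix comes from the identity by adding \<open>c\<close> times row \<open>i\<close>
  to row \<open>j\<close>, which preserves the determinant. Transvections are therefore available in
  every \<open>H\<close> containing \<open>PSL\<close>.\<close>

lemma shear_SL:
  assumes "i \<noteq> j"
  shows "shear c i j \<in> SL"
proof -
  have "Vector_Spaces.linear (*s) (*s) (shear c i j)"
    unfolding Vector_Spaces.linear_iff
    using vec.vector_space_axioms by (auto simp: shear_def vec_eq_iff algebra_simps)
  moreover have "bij (shear c i j)"
    by (rule o_bij[of "shear (- c) i j"]) (simp_all add: fun_eq_iff shear_inverse[OF assms])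
  moreover have "matrix (shear c i j) =
      (\<chi> k. if k = j then row j (mat 1) + c *s row i (mat 1) else row k (mat 1))"
    using assms by (auto simp: matrix_def shear_def row_def mat_def axis_def vec_eq_iff)
  then have "det (matrix (shear c i j)) = 1"
    using det_row_operation[of j i "mat 1" c] assms by simp
  ultimately show ?thesis by (simp add: SL_def GL_def)
qed

lemma shear_image:
  assumes "i \<noteq> j" "\<And>v. v \<in> U \<Longrightarrow> shear c i j v \<in> W" "\<And>v. v \<in> W \<Longrightarrow> shear (- c) i j v \<in> U"
  shows "shear c i j ` U = W"
proof
  show "shear c i j ` U \<subseteq> W" using assms(2) by blast
  show "W \<subseteq> shear c i j ` U"
  proof
    fix w assume "w \<in> W"
    then show "w \<in> shear c i j ` U"
      using assms(3) shear_inverse(2)[OF assms(1), of c w] by (intro image_eqI[of _ _ "shear (- c) i j w"]) auto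
  qed
qed

lemma SL_GammaL: "f \<in> SL \<Longrightarrow> f \<in> carrier GammaL"
  using GL_semilinear by (auto simp: SL_def GammaL_def GL_def)

text \<open>With \<open>E = {axis i 1 | i \<notin> B}\<close> and \<open>F = {axis j 1 | j \<in> B}\<close>, the stabiliser of the subspaces
  \<open>\<langle>e\<^sub>i, F - {f\<^sub>j}\<rangle>\<close> fixes every \<open>\<langle>e\<^sub>i\<rangle>\<close>, so it does not map
  \<open>W 0 = \<langle>\<Sum> e\<^sub>i, f\<^sub>j - f\<^sub>l\<rangle>\<close> to \<open>W 1 = \<langle>\<Sum> e\<^sub>i + f\<^sub>j, f\<^sub>j - f\<^sub>l\<rangle>\<close>. If one of them is dropped, the
  transvection \<open>e\<^sub>i \<mapsto> e\<^sub>i + f\<^sub>j\<close> does.\<close>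

lemma RC_bound_subspaces_gt:
  fixes H :: "('a::{field,finite} ^ 'n \<Rightarrow> 'a ^ 'n) set set"
  assumes H: "H \<subseteq> carrier PGammaL" "PSL \<subseteq> H" and m: "1 \<le> m" "m < CARD('n)"
    and RC: "RC_bound H (subspaces_of_dim m) (subspace_action m) r"
  shows "m * (CARD('n) - m) < r"
proof (rule ccontr)
  assume "\<not> m * (CARD('n) - m) < r"
  then have r: "r \<le> m * (CARD('n) - m)" by simp
  obtain B :: "'n set" where B: "card B = m"
    using obtain_subset_with_card_n[of m "UNIV :: 'n set"] m by auto
  have cA: "card (- B) = CARD('n) - m" using B by (simp add: Compl_eq_Diff_UNIV card_Diff_subset)
  obtain b0 where b0: "b0 \<in> B" using B m by fastforce
  have "- B \<noteq> {}" using cA m by (metis card.empty not_less0 zero_less_diff)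
  then obtain a0 where a0: "a0 \<notin> B" by blast
  obtain ps where ps: "set ps = (- B) \<times> B" "distinct ps"
    using finite_distinct_list[of "(- B) \<times> B"] by auto
  have lps: "length ps = m * (CARD('n) - m)"
    using distinct_card[OF ps(2)] ps(1) B cA by (simp add: card_cartesian_product mult.commute)
  \<comment> \<open>The spans are encoded by coordinate equations: \<open>Z i j\<close> is spanned
    by \<open>e_i\<close> and the \<open>f_l\<close> with \<open>l \<noteq> j\<close>, and in
    \<open>W t\<close> the coordinates outside \<open>B\<close> share one value whose
    \<open>t\<close>-fold is the sum of those in \<open>B\<close>.\<close>
  define Z :: "'n \<Rightarrow> 'n \<Rightarrow> ('a ^ 'n) set"
    where "Z i j = {v. \<forall>k. k \<notin> insert i (B - {j}) \<longrightarrow> v $ k = 0}" for i j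
  define W where "W t = {v :: 'a ^ 'n. (\<forall>k. k \<notin> B \<longrightarrow> v $ k = v $ a0) \<and> (\<Sum>k\<in>B. v $ k) = t * v $ a0}" for t
  have W_D: "v $ k = v $ a0" if "v \<in> W t" "k \<notin> B" for v t k
    using that unfolding W_def by blast
  have W_sum: "(\<Sum>k\<in>B. v $ k) = t * v $ a0" if "v \<in> W t" for v t
    using that unfolding W_def by blast
  have W_I: "v \<in> W t" if "\<And>k. k \<notin> B \<Longrightarrow> v $ k = v $ a0" "(\<Sum>k\<in>B. v $ k) = t * v $ a0" for v t
    using that unfolding W_def by blast
  \<comment> \<open>The tuples differ only in entry 0 and have one entry more than there are pairs
    \<open>(i, j)\<close>.\<close>
  define X where "X = W 0 # map (\<lambda>(i, j). Z i j) ps"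
  define Y where "Y = W 1 # map (\<lambda>(i, j). Z i j) ps"
  have Zdim: "Z i j \<in> subspaces_of_dim m" if "i \<notin> B" "j \<in> B" for i j
  proof -
    have "vec.subspace (Z i j)" by (rule vec.subspaceI) (auto simp: Z_def)
    moreover have "card (insert i (B - {j})) = m" using that B m by (simp add: card_insert_if)
    ultimately show ?thesis
      unfolding subspaces_of_dim_def Z_def by (simp only: dim_substandard_cart mem_Collect_eq)
  qed
  have W0dim: "W 0 \<in> subspaces_of_dim m"
  proof -
    have sub: "vec.subspace (W 0)"
    proof (rule vec.subspaceI)
      show "0 \<in> W 0" by (rule W_I) simp_all
    next
      fix u v assume uv: "u \<in> W 0" "v \<in> W 0"
      show "u + v \<in> W 0"
        by (rule W_I) (simp_all add: W_D[OF uv(1)] W_D[OF uv(2)] sum.distrib W_sum[OF uv(1)] W_sum[OF uv(2)])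
    next
      fix c v assume v: "v \<in> W 0"
      show "c *s v \<in> W 0"
        by (rule W_I) (simp_all add: W_D[OF v] W_sum[OF v] flip: sum_distrib_left)
    qed
    \<comment> \<open>\<open>W 0\<close> is compared with the coordinate space
      \<open>Z a0 b0\<close>: its \<open>b0\<close>-coordinate is determined by the others in
      \<open>B\<close>, and the coordinates outside \<open>B\<close> by the one at
      \<open>a0\<close>. Equal cardinalities give equal dimensions.\<close>
    define f where "f v = (\<chi> k. if k \<notin> B then v $ a0 else if k = b0 then - (\<Sum>l\<in>B - {b0}. v $ l) else v $ k)"
      for v :: "'a ^ 'n"
    define g where "g v = (\<chi> k. if k \<in> insert a0 (B - {b0}) then v $ k else 0)" for v :: "'a ^ 'n"
    have sumB: "(\<Sum>k\<in>B. h k) = h b0 + (\<Sum>k\<in>B - {b0}. h k)" for h :: "'n \<Rightarrow> 'a"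
      using b0 by (simp add: sum.remove)
    have f_sum: "(\<Sum>l\<in>B - {b0}. f v $ l) = (\<Sum>l\<in>B - {b0}. v $ l)" for v
      by (rule sum.cong) (auto simp: f_def)
    have g_sum: "(\<Sum>l\<in>B - {b0}. g v $ l) = (\<Sum>l\<in>B - {b0}. v $ l)" for v
      by (rule sum.cong) (auto simp: g_def)
    have "bij_betw f (Z a0 b0) (W 0)"
    proof (rule bij_betw_byWitness[where f' = g])
      show "\<forall>v\<in>Z a0 b0. g (f v) = v"
        using a0 by (auto simp: Z_def f_def g_def vec_eq_iff)
      show "\<forall>v\<in>W 0. f (g v) = v"
      proof
        fix v assume v: "v \<in> W 0"
        have b: "v $ b0 = - (\<Sum>l\<in>B - {b0}. v $ l)"
          using W_sum[OF v] by (simp add: sumB eq_neg_iff_add_eq_0)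
        have "f (g v) $ k = v $ k" for k
        proof (cases "k \<in> B")
          case True
          show ?thesis
          proof (cases "k = b0")
            case True
            then show ?thesis using b0 b g_sum[of v] by (simp add: f_def)
          next
            case False
            with True show ?thesis by (simp add: f_def g_def)
          qed
        next
          case False
          then have "f (g v) $ k = v $ a0" by (simp add: f_def g_def)
          then show ?thesis using W_D[OF v False] by simp
        qed
        then show "f (g v) = v" by (simp add: vec_eq_iff)
      qed
      show "f ` Z a0 b0 \<subseteq> W 0"
      proof clarify
        fix v
        show "f v \<in> W 0"
        proof (rule W_I)
          show "f v $ k = f v $ a0" if "k \<notin> B" for k using that a0 by (simp add: f_def)
          have "f v $ b0 = - (\<Sum>l\<in>B - {b0}. v $ l)" using b0 by (simp add: f_def)
          then show "(\<Sum>k\<in>B. f v $ k) = 0 * f v $ a0" unfolding sumB f_sum by simp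
        qed
      qed
      show "g ` W 0 \<subseteq> Z a0 b0"
        by (auto simp: Z_def g_def)
    qed
    then have "card (Z a0 b0) = card (W 0)" by (rule bij_betw_same_card)
    moreover have "CARD('a) > 1" using two_le_CARD_field[where ?'a = 'a] by simp
    ultimately show ?thesis
      using sub Zdim[OF a0 b0] by (simp add: subspaces_of_dim_def card_subspace)
  qed
  \<comment> \<open>Either coordinate \<open>i\<close> vanishes on \<open>Z i' j'\<close>, or
    \<open>i = i'\<close> and coordinate \<open>j\<close> is unconstrained there.\<close>
  have shear_Z: "shear c i j ` Z i' j' = Z i' j'"
    if "i \<notin> B" "j \<in> B" "i' \<notin> B" "j' \<in> B" "(i, j) \<noteq> (i', j')" for c i j i' j'
    by (rule shear_image) (use that in \<open>auto simp: Z_def shear_def\<close>)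
  have shear_W: "shear c i j v \<in> W (t + c)" if "i \<notin> B" "j \<in> B" "v \<in> W t" for i j c t v
  proof (rule W_I)
    have A: "shear c i j v $ k = v $ k" if "k \<notin> B" for k
      using that \<open>j \<in> B\<close> by (auto simp: shear_def)
    show "shear c i j v $ k = shear c i j v $ a0" if "k \<notin> B" for k
      unfolding A[OF that] A[OF a0] by (rule W_D[OF \<open>v \<in> W t\<close> that])
    have "(\<Sum>k\<in>B. shear c i j v $ k) = (\<Sum>k\<in>B. v $ k + (if k = j then c * v $ i else 0))"
      by (rule sum.cong) (auto simp: shear_def)
    also have "\<dots> = t * v $ a0 + c * v $ i"
      using that by (simp add: sum.distrib W_sum)
    finally show "(\<Sum>k\<in>B. shear c i j v $ k) = (t + c) * shear c i j v $ a0"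
      unfolding A[OF a0] W_D[OF that(3,1)] by (simp add: distrib_right)
  qed
  have shear_X0: "shear 1 i j ` W 0 = W 1" if "i \<notin> B" "j \<in> B" for i j
    by (rule shear_image) (use that shear_W[OF that, of _ 0 1] shear_W[OF that, of _ 1 "- 1"] in auto)
  have ab: "a0 \<noteq> b0" using a0 b0 by blast
  have W1dim: "W 1 \<in> subspaces_of_dim m"
    unfolding shear_X0[OF a0 b0, symmetric]
    by (rule GammaL_image_subspaces_of_dim[OF SL_GammaL[OF shear_SL[OF ab]] W0dim])
  have Zps: "(\<lambda>(i, j). Z i j) p \<in> subspaces_of_dim m" if "p \<in> set ps" for p
    using that ps(1) Zdim by auto
  have setX: "set X \<subseteq> subspaces_of_dim m" and setY: "set Y \<subseteq> subspaces_of_dim m"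
    using W0dim W1dim Zps by (auto simp: X_def Y_def)
  have len: "length X = Suc (length ps)" "length Y = Suc (length ps)"
    by (simp_all add: X_def Y_def)
  have act: "subspace_action m (scalars #>\<^bsub>GammaL\<^esub> shear c i j) (X ! l) = shear c i j ` (X ! l)"
    if "i \<noteq> j" "l < length X" for c i j l
    using setX that by (intro subspace_action_eq SL_GammaL shear_SL) auto
  have inH: "scalars #>\<^bsub>GammaL\<^esub> shear c i j \<in> H" if "i \<noteq> j" for c i j
    using shear_SL[OF that, of c] H(2) by (auto simp: PSL_def)
  have "r_equivalent r H (subspace_action m) X Y"
    unfolding r_equivalent_def
  proof (intro allI impI, elim conjE)
    fix I assume I: "I \<subseteq> {..<length X}" "card I = r"
    \<comment> \<open>At least one position \<open>p\<close> is left out: if it is 0, the identity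
      takes \<open>X\<close> to \<open>Y\<close> on \<open>I\<close>; otherwise the transvection of
      the pair at \<open>p\<close> does.\<close>
    have "I \<noteq> {..<length X}" using I(2) r lps len(1) by auto
    then obtain p where p: "p < length X" "p \<notin> I" using I(1) by blast
    show "\<exists>h\<in>H. \<forall>l\<in>I. subspace_action m h (X ! l) = Y ! l"
    proof (cases p)
      case 0
      \<comment> \<open>The identity is written as a transvection, so that \<open>inH\<close> and
        \<open>act\<close> cover it.\<close>
      have id: "shear 0 a0 b0 = id" by (auto simp: shear_def vec_eq_iff fun_eq_iff)
      have "subspace_action m (scalars #>\<^bsub>GammaL\<^esub> shear 0 a0 b0) (X ! l) = Y ! l" if "l \<in> I" for l
      proof -
        have "l < length X" using I(1) that by auto
        from act[OF ab this, of 0] have "subspace_action m (scalars #>\<^bsub>GammaL\<^esub> shear 0 a0 b0) (X ! l) = X ! l"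
          by (simp add: id)
        also have "X ! l = Y ! l" using that p(2) 0 by (cases l) (auto simp: X_def Y_def)
        finally show ?thesis .
      qed
      then show ?thesis using inH[OF ab] by blast
    next
      case (Suc p')
      obtain i j where ij: "ps ! p' = (i, j)" by fastforce
      have p': "p' < length ps" using p(1) Suc len by simp
      then have "(i, j) \<in> set ps" using ij by (metis nth_mem)
      then have ijB: "i \<notin> B" "j \<in> B" using ps(1) by auto
      then have ne: "i \<noteq> j" by blast
      have "shear 1 i j ` (X ! l) = Y ! l" if l: "l \<in> I" for l
      proof (cases l)
        case 0
        then show ?thesis using shear_X0[OF ijB] by (simp add: X_def Y_def)
      next
        case (Suc l')
        obtain i' j' where ij': "ps ! l' = (i', j')" by fastforce
        have l': "l' < length ps" using I(1) l Suc len by auto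
        then have "(i', j') \<in> set ps" using ij' by (metis nth_mem)
        then have "i' \<notin> B" "j' \<in> B" using ps(1) by auto
        moreover have "(i, j) \<noteq> (i', j')"
          using ps(2) l' p' ij ij' l p(2) Suc \<open>p = Suc p'\<close> by (metis nth_eq_iff_index_eq)
        ultimately show ?thesis
          using shear_Z[OF ijB] Suc l' ij' by (simp add: X_def Y_def)
      qed
      then have "\<forall>l\<in>I. subspace_action m (scalars #>\<^bsub>GammaL\<^esub> shear 1 i j) (X ! l) = Y ! l"
        using act[OF ne] I(1) by auto
      then show ?thesis using inH[OF ne] by blast
    qed
  qed
  then obtain C where C: "C \<in> H" "map (subspace_action m C) X = Y"
    using RC setX setY len r lps unfolding RC_bound_def by (metis le_SucI)
  obtain f where f: "f \<in> carrier GammaL" "C = scalars #>\<^bsub>GammaL\<^esub> f"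
    using C(1) H(1) by (auto simp: PGammaL_def FactGroup_def RCOSETS_def)
  have img: "f ` (X ! l) = Y ! l" if "l < length X" for l
  proof -
    have "subspace_action m C (X ! l) = Y ! l"
      using that C(2) by (metis nth_map)
    moreover have "X ! l \<in> subspaces_of_dim m" using setX that by auto
    ultimately show ?thesis using subspace_action_eq[OF f(1)] f(2) by simp
  qed
  have fX0: "f ` W 0 = W 1" using img[of 0] by (simp add: X_def Y_def)
  have fZ: "f ` Z i j = Z i j" if "i \<notin> B" "j \<in> B" for i j
  proof -
    have "(i, j) \<in> set ps" using that ps(1) by simp
    then obtain l where "l < length ps" "ps ! l = (i, j)" by (auto simp: in_set_conv_nth)
    then show ?thesis using img[of "Suc l"] by (simp add: X_def Y_def)
  qed
  have bij: "bij f" and add: "\<And>u v. f (u + v) = f u + f v"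
    using f(1) by (auto simp: GammaL_def semilinear_def)
  have f0: "f 0 = 0" using add[of 0 0] by simp
  have fsum: "f (sum h S) = (\<Sum>x\<in>S. f (h x))" for h and S :: "'n set"
    by (induction S rule: infinite_finite_induct) (simp_all add: f0 add)
  \<comment> \<open>The intersection of the \<open>Z i j\<close> over all \<open>j\<close> in
    \<open>B\<close> is the line through \<open>axis i 1\<close>, so \<open>f\<close> maps
    \<open>axis i 1\<close> into that line.\<close>
  have axis: "f (axis i 1) $ k = 0" if "i \<notin> B" "k \<noteq> i" for i k
  proof -
    have Z: "f (axis i 1) \<in> Z i j" if "j \<in> B" for j
    proof -
      have "axis i 1 \<in> Z i j" by (auto simp: Z_def axis_def)
      then show ?thesis using fZ[OF \<open>i \<notin> B\<close> that] by blast
    qed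
    show ?thesis
    proof (cases "k \<in> B")
      case True
      then show ?thesis using Z[OF True] that by (auto simp: Z_def)
    next
      case False
      then show ?thesis using Z[OF b0] that by (auto simp: Z_def)
    qed
  qed
  \<comment> \<open>\<open>u\<close> is the sum of the \<open>e_i\<close>; the coordinates of
    \<open>f u\<close> in \<open>B\<close> are zero, so the equation of \<open>W 1\<close> forces
    coordinate \<open>a0\<close> of \<open>f u\<close>, and with it \<open>f (axis a0 1)\<close>, to
    vanish.\<close>
  define u :: "'a ^ 'n" where "u = (\<Sum>i\<in>- B. axis i 1)"
  have "u $ k = (if k \<in> B then 0 else 1)" for k
  proof -
    have "u $ k = (\<Sum>i\<in>- B. if i = k then 1 else 0)"
      unfolding u_def sum_component by (rule sum.cong) (auto simp: axis_def)
    then show ?thesis by simp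
  qed
  then have "u \<in> W 0" using a0 by (intro W_I) simp_all
  then have "f u \<in> W 1" using fX0 by blast
  moreover have fu: "f u $ k = (\<Sum>i\<in>- B. f (axis i 1) $ k)" for k
    unfolding u_def fsum sum_component ..
  have "f u $ k = 0" if "k \<in> B" for k
    unfolding fu
  proof (intro sum.neutral ballI)
    fix i assume "i \<in> - B"
    then have "i \<notin> B" "k \<noteq> i" using that by auto
    then show "f (axis i 1) $ k = 0" by (rule axis)
  qed
  ultimately have "f u $ a0 = 0" using W_sum[of "f u" 1] by simp
  moreover have "f u $ a0 = f (axis a0 1) $ a0"
  proof -
    have "f u $ a0 = (\<Sum>i\<in>- B. if i = a0 then f (axis a0 1) $ a0 else 0)"
      unfolding fu using axis by (intro sum.cong) auto
    then show ?thesis using a0 by simp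
  qed
  ultimately have "f (axis a0 1) $ k = 0" for k
    using axis[OF a0] by (cases "k = a0") auto
  then have "f (axis a0 1) = f 0" by (simp add: f0 vec_eq_iff)
  then have "axis a0 (1 :: 'a) = 0" using bij by (simp add: bij_is_inj inj_eq)
  then show False by (simp add: axis_eq_0_iff)
qed

section \<open>Semilinear stabilisers and the upper bound\<close>

text \<open>The automorphism is made a parameter, because composing, inverting and comparing maps
  must keep track of it.\<close>

definition semilinear_for :: "('a::field \<Rightarrow> 'a) \<Rightarrow> ('a ^ 'n \<Rightarrow> 'a ^ 'n) \<Rightarrow> bool"
  where "semilinear_for \<sigma> f \<longleftrightarrow> (\<forall>u v. f (u + v) = f u + f v) \<and> (\<forall>c v. f (c *s v) = \<sigma> c *s f v)"

lemma semilinear_iff: "semilinear f \<longleftrightarrow> (\<exists>\<sigma>. field_automorphism \<sigma> \<and> semilinear_for \<sigma> f)"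
  by (simp add: semilinear_def semilinear_for_def)

lemma GL_iff: "f \<in> GL \<longleftrightarrow> bij f \<and> semilinear_for id f"
  using vec.vector_space_axioms by (auto simp: GL_def Vector_Spaces.linear_iff semilinear_for_def)

lemma semilinear_for_comp:
  assumes "semilinear_for \<sigma> f" "semilinear_for \<tau> g"
  shows "semilinear_for (\<sigma> \<circ> \<tau>) (f \<circ> g)"
  using assms by (simp add: semilinear_for_def)

lemma semilinear_for_inv:
  assumes "semilinear_for \<sigma> f" "bij f" "bij \<sigma>"
  shows "semilinear_for (inv_into UNIV \<sigma>) (inv_into UNIV f)"
proof -
  have f: "f (inv_into UNIV f v) = v" "\<sigma> (inv_into UNIV \<sigma> c) = c" for v c
    using assms by (simp_all add: bij_is_surj surj_f_inv_f)
  have inj: "inj f" using assms(2) by (rule bij_is_inj)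
  have "inv_into UNIV f (u + v) = inv_into UNIV f u + inv_into UNIV f v" for u v
    by (rule injD[OF inj]) (use assms(1) in \<open>simp add: semilinear_for_def f\<close>)
  moreover have "inv_into UNIV f (c *s v) = inv_into UNIV \<sigma> c *s inv_into UNIV f v" for c v
    by (rule injD[OF inj]) (use assms(1) in \<open>simp add: semilinear_for_def f\<close>)
  ultimately show ?thesis by (simp add: semilinear_for_def)
qed

text \<open>A bijective additive map sends a nonzero vector to a nonzero one, whose multiples tell
  \<open>\<sigma> c\<close> from \<open>\<tau> c\<close>; the index \<open>undefined\<close> is an
  arbitrary coordinate.\<close>

lemma semilinear_for_unique:
  fixes f :: "'a::field ^ 'n \<Rightarrow> 'a ^ 'n"
  assumes "semilinear_for \<sigma> f" "semilinear_for \<tau> f" "bij f"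
  shows "\<sigma> = \<tau>"
proof
  fix c
  have "f (0 + 0) = f 0 + f 0" using assms(1) unfolding semilinear_for_def by blast
  then have "f 0 = 0" by (metis add_0 add_cancel_right_right)
  moreover have "axis undefined (1 :: 'a) \<noteq> (0 :: 'a ^ 'n)"
    by (simp add: axis_eq_0_iff)
  ultimately have "f (axis undefined 1) \<noteq> 0"
    using assms(3) by (metis bij_is_inj inj_eq)
  moreover have "\<sigma> c *s f (axis undefined 1) = \<tau> c *s f (axis undefined 1)"
    using assms(1,2) unfolding semilinear_for_def by metis
  ultimately show "\<sigma> c = \<tau> c" by simp
qed

section \<open>From the group \<open>H\<close> to its preimage in \<open>GammaL\<close>\<close>

lemma inv_GammaL:
  assumes "f \<in> carrier GammaL"
  shows "inv\<^bsub>GammaL\<^esub> f = inv_into UNIV f"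
proof -
  interpret group GammaL by (rule group_GammaL)
  show ?thesis
    by (rule inv_equality)
      (use assms in \<open>auto simp: GammaL_def semilinear_inv bij_imp_bij_inv bij_is_inj\<close>)
qed

lemma group_hom_PGammaL:
  "group_hom (GammaL :: ('a::field ^ 'n \<Rightarrow> 'a ^ 'n) monoid) PGammaL (\<lambda>f. scalars #>\<^bsub>GammaL\<^esub> f)"
  unfolding group_hom_def group_hom_axioms_def PGammaL_def
  using group_GammaL group_PGammaL normal.r_coset_hom_Mod[OF normal_scalars]
  by (simp add: PGammaL_def)

text \<open>The full preimage of \<open>H\<close> under reduction modulo scalars; stabilisers are
  computed there with actual maps instead of cosets.\<close>

definition semilinear_preimage :: "('a::field ^ 'n \<Rightarrow> 'a ^ 'n) set set \<Rightarrow> ('a ^ 'n \<Rightarrow> 'a ^ 'n) set"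
  where "semilinear_preimage H = {f \<in> carrier GammaL. scalars #>\<^bsub>GammaL\<^esub> f \<in> H}"

lemma semilinear_preimage_rep:
  assumes "H \<subseteq> carrier PGammaL"
  shows "H = (\<lambda>f. scalars #>\<^bsub>GammaL\<^esub> f) ` semilinear_preimage H"
  using assms by (auto simp: semilinear_preimage_def PGammaL_def FactGroup_def RCOSETS_def)

lemma semilinear_preimage_closed:
  assumes "subgroup H PGammaL"
  shows "id \<in> semilinear_preimage H"
    and "f \<in> semilinear_preimage H \<Longrightarrow> g \<in> semilinear_preimage H \<Longrightarrow> f \<circ> g \<in> semilinear_preimage H"
    and "f \<in> semilinear_preimage H \<Longrightarrow> inv_into UNIV f \<in> semilinear_preimage H"
proof -
  interpret P: group_hom GammaL PGammaL "\<lambda>f. scalars #>\<^bsub>GammaL\<^esub> f" by (rule group_hom_PGammaL)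
  interpret H: subgroup H PGammaL by fact
  have one: "id = \<one>\<^bsub>GammaL\<^esub>" and mult: "f \<circ> g = f \<otimes>\<^bsub>GammaL\<^esub> g" for f g :: "'a ^ 'b \<Rightarrow> 'a ^ 'b"
    by (simp_all add: GammaL_def)
  show "id \<in> semilinear_preimage H"
    unfolding semilinear_preimage_def one using H.one_closed P.hom_one by auto
  show "f \<circ> g \<in> semilinear_preimage H" if "f \<in> semilinear_preimage H" "g \<in> semilinear_preimage H"
    using that H.m_closed unfolding semilinear_preimage_def mult by auto
  show "inv_into UNIV f \<in> semilinear_preimage H" if "f \<in> semilinear_preimage H"
  proof -
    have f: "f \<in> carrier GammaL" "scalars #>\<^bsub>GammaL\<^esub> f \<in> H"
      using that by (auto simp: semilinear_preimage_def)
    then have "inv\<^bsub>GammaL\<^esub> f \<in> semilinear_preimage H"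
      using H.m_inv_closed P.hom_inv by (auto simp: semilinear_preimage_def)
    then show ?thesis using inv_GammaL[OF f(1)] by simp
  qed
qed

text \<open>For a group \<open>K\<close> of semilinear bijections this is its image in the
  automorphism group of the field; for the preimage of \<open>H\<close> its order is the index
  \<open>e\<close>.\<close>

definition twists :: "('a::field ^ 'n \<Rightarrow> 'a ^ 'n) set \<Rightarrow> ('a \<Rightarrow> 'a) set"
  where "twists K = {\<sigma>. field_automorphism \<sigma> \<and> (\<exists>f\<in>K. semilinear_for \<sigma> f)}"

lemma aut_subgroup_twists:
  fixes K :: "('a::field ^ 'n \<Rightarrow> 'a ^ 'n) set"
  assumes "id \<in> K" "\<And>f g. f \<in> K \<Longrightarrow> g \<in> K \<Longrightarrow> f \<circ> g \<in> K"
    and "\<And>f. f \<in> K \<Longrightarrow> inv_into UNIV f \<in> K" "\<And>f. f \<in> K \<Longrightarrow> bij f"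
  shows "aut_subgroup (twists K)"
  unfolding aut_subgroup_def
proof (intro conjI ballI)
  show "id \<in> twists K"
    using assms(1) field_automorphism_id
    by (auto simp: twists_def semilinear_for_def intro!: bexI[of _ id])
  fix \<sigma> assume "\<sigma> \<in> twists K"
  then obtain f where f: "field_automorphism \<sigma>" "f \<in> K" "semilinear_for \<sigma> f"
    by (auto simp: twists_def)
  show "field_automorphism \<sigma>" by fact
  have "bij \<sigma>" using f(1) by (simp add: field_automorphism_def)
  then show "inv_into UNIV \<sigma> \<in> twists K"
    using field_automorphism_inv[OF f(1)] semilinear_for_inv[OF f(3)] assms f(2)
    by (auto simp: twists_def)
  fix \<tau> assume "\<tau> \<in> twists K"
  then obtain g where g: "field_automorphism \<tau>" "g \<in> K" "semilinear_for \<tau> g"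
    by (auto simp: twists_def)
  have "field_automorphism (\<sigma> \<circ> \<tau>)"
    using f(1) g(1) by (auto simp: field_automorphism_def bij_comp)
  then show "\<sigma> \<circ> \<tau> \<in> twists K"
    using semilinear_for_comp[OF f(3) g(3)] assms(2)[OF f(2) g(2)] by (auto simp: twists_def)
qed

text \<open>The first isomorphism theorem as an equality of cardinalities.\<close>

lemma card_rcosets_kernel:
  assumes "group_hom G G' h"
  shows "card (rcosets\<^bsub>G\<^esub> (kernel G G' h)) = card (h ` carrier G)"
proof -
  interpret group_hom G G' h by fact
  have "the_elem (h ` (kernel G G' h #>\<^bsub>G\<^esub> x)) = h x" if "x \<in> carrier G" for x
  proof -
    have "h ` (kernel G G' h #>\<^bsub>G\<^esub> x) = {h x}"
      using that by (auto simp: kernel_def r_coset_def intro!: imageI)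
    then show ?thesis by simp
  qed
  then have "(\<lambda>A. the_elem (h ` A)) ` carrier (G Mod kernel G G' h) = h ` carrier G"
    unfolding carrier_FactGroup image_image by (intro image_cong) simp_all
  then show ?thesis
    using card_image[OF FactGroup_inj_on] by (simp add: FactGroup_def)
qed

text \<open>Sending a coset to its field automorphism is a homomorphism on \<open>H\<close> whose
  kernel is \<open>H \<inter> PGL\<close> and whose image is the set of twists.\<close>

lemma group_index_PGL:
  fixes H :: "('a::field ^ 'n \<Rightarrow> 'a ^ 'n) set set"
  assumes "subgroup H PGammaL"
  shows "group_index PGammaL H (H \<inter> PGL) = card (twists (semilinear_preimage H))"
proof -
  define Aut :: "('a \<Rightarrow> 'a) monoid"
    where "Aut = \<lparr>carrier = {\<sigma>. field_automorphism \<sigma>}, monoid.mult = (\<circ>), one = id\<rparr>"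
  \<comment> \<open>Scalars do not change the automorphism of a semilinear bijection, so the
    description is unique on every coset.\<close>
  define tw where "tw C = (THE \<sigma>. \<exists>f\<in>C. field_automorphism \<sigma> \<and> semilinear_for \<sigma> f)"
    for C :: "('a ^ 'n \<Rightarrow> 'a ^ 'n) set"
  interpret P: group_hom "GammaL :: ('a ^ 'n \<Rightarrow> 'a ^ 'n) monoid" PGammaL "\<lambda>f. scalars #>\<^bsub>GammaL\<^esub> f"
    by (rule group_hom_PGammaL)
  let ?G = "PGammaL\<lparr>carrier := H\<rparr>"
  have tw: "tw (scalars #>\<^bsub>GammaL\<^esub> f) = \<sigma>"
    if "bij f" "field_automorphism \<sigma>" "semilinear_for \<sigma> f" for f :: "'a ^ 'n \<Rightarrow> 'a ^ 'n" and \<sigma>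
    unfolding tw_def
  proof (rule the_equality)
    have eq: "scalars #>\<^bsub>GammaL\<^esub> f = {(*s) c \<circ> f | c. c \<noteq> 0}"
      by (auto simp: r_coset_def scalars_def GammaL_def)
    have "(*s) 1 \<circ> f = f" by (simp add: fun_eq_iff)
    then have "f \<in> scalars #>\<^bsub>GammaL\<^esub> f" unfolding eq by (auto intro!: exI[of _ 1])
    then show "\<exists>g\<in>scalars #>\<^bsub>GammaL\<^esub> f. field_automorphism \<sigma> \<and> semilinear_for \<sigma> g"
      using that by blast
    fix \<tau> assume "\<exists>g\<in>scalars #>\<^bsub>GammaL\<^esub> f. field_automorphism \<tau> \<and> semilinear_for \<tau> g"
    then obtain c where c: "c \<noteq> 0" "semilinear_for \<tau> ((*s) c \<circ> f)" unfolding eq by blast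
    have "semilinear_for \<sigma> ((*s) c \<circ> f)"
      using that(3) by (simp add: semilinear_for_def vec.scale_right_distrib mult.commute)
    moreover have "bij ((*s) c :: 'a ^ 'n \<Rightarrow> 'a ^ 'n)"
      by (rule o_bij[of "(*s) (inverse c)"]) (use c in \<open>auto simp: fun_eq_iff\<close>)
    ultimately show "\<tau> = \<sigma>"
      using c(2) semilinear_for_unique that(1) bij_comp by blast
  qed
  have rep: "\<exists>f \<sigma>. f \<in> semilinear_preimage H \<and> bij f \<and> C = scalars #>\<^bsub>GammaL\<^esub> f \<and>
      field_automorphism \<sigma> \<and> semilinear_for \<sigma> f \<and> tw C = \<sigma>" if C: "C \<in> H" for C
  proof -
    obtain f where f: "f \<in> semilinear_preimage H" "C = scalars #>\<^bsub>GammaL\<^esub> f"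
      using C semilinear_preimage_rep[OF subgroup.subset[OF assms]] by blast
    then have b: "bij f" "semilinear f" by (auto simp: semilinear_preimage_def GammaL_def)
    then obtain \<sigma> where "field_automorphism \<sigma>" "semilinear_for \<sigma> f" by (auto simp: semilinear_iff)
    with f b(1) tw show ?thesis by blast
  qed
  have "group Aut"
  proof (rule groupI)
    fix \<sigma> assume "\<sigma> \<in> carrier Aut"
    then show "\<exists>\<tau>\<in>carrier Aut. \<tau> \<otimes>\<^bsub>Aut\<^esub> \<sigma> = \<one>\<^bsub>Aut\<^esub>"
      using field_automorphism_inv[of \<sigma>]
      by (intro bexI[of _ "inv_into UNIV \<sigma>"]) (auto simp: Aut_def field_automorphism_def bij_is_inj)
  qed (auto simp: Aut_def field_automorphism_id o_assoc, auto simp: field_automorphism_def bij_comp)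
  moreover have "group ?G"
    using subgroup.subgroup_is_group[OF assms P.H.group_axioms] .
  moreover have "tw \<in> hom ?G Aut"
  proof (rule homI)
    show "tw C \<in> carrier Aut" if "C \<in> carrier ?G" for C
      using rep[of C] that by (auto simp: Aut_def)
    fix C D assume "C \<in> carrier ?G" "D \<in> carrier ?G"
    then obtain f \<sigma> g \<tau> where f: "f \<in> semilinear_preimage H" "bij f" "C = scalars #>\<^bsub>GammaL\<^esub> f"
        "field_automorphism \<sigma>" "semilinear_for \<sigma> f" "tw C = \<sigma>"
      and g: "g \<in> semilinear_preimage H" "bij g" "D = scalars #>\<^bsub>GammaL\<^esub> g"
        "field_automorphism \<tau>" "semilinear_for \<tau> g" "tw D = \<tau>"
      using rep[of C] rep[of D] by auto
    have "C \<otimes>\<^bsub>?G\<^esub> D = scalars #>\<^bsub>GammaL\<^esub> (f \<otimes>\<^bsub>GammaL\<^esub> g)"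
      using f(1,3) g(1,3) P.hom_mult by (simp add: semilinear_preimage_def)
    also have "f \<otimes>\<^bsub>GammaL\<^esub> g = f \<circ> g" by (simp add: GammaL_def)
    also have "tw (scalars #>\<^bsub>GammaL\<^esub> (f \<circ> g)) = \<sigma> \<circ> \<tau>"
    proof (rule tw)
      show "bij (f \<circ> g)" using f(2) g(2) by (simp add: bij_comp)
      show "field_automorphism (\<sigma> \<circ> \<tau>)"
        using f(4) g(4) by (auto simp: field_automorphism_def bij_comp)
      show "semilinear_for (\<sigma> \<circ> \<tau>) (f \<circ> g)" using f(5) g(5) by (rule semilinear_for_comp)
    qed
    finally show "tw (C \<otimes>\<^bsub>?G\<^esub> D) = tw C \<otimes>\<^bsub>Aut\<^esub> tw D"
      using f(6) g(6) by (simp add: Aut_def comp_def)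
  qed
  ultimately interpret T: group_hom ?G Aut tw
    by (simp add: group_hom_def group_hom_axioms_def)
  have "kernel ?G Aut tw = H \<inter> PGL"
  proof (intro subset_antisym subsetI)
    fix C assume "C \<in> kernel ?G Aut tw"
    then have C: "C \<in> H" "tw C = id" by (auto simp: kernel_def Aut_def)
    then obtain f where f: "bij f" "C = scalars #>\<^bsub>GammaL\<^esub> f" "semilinear_for id f"
      using rep[OF C(1)] by auto
    then have "f \<in> GL" by (simp add: GL_iff)
    with f C(1) show "C \<in> H \<inter> PGL" by (auto simp: PGL_def)
  next
    fix C assume C: "C \<in> H \<inter> PGL"
    then obtain f where f: "f \<in> GL" "C = scalars #>\<^bsub>GammaL\<^esub> f" by (auto simp: PGL_def)
    then have "tw C = id"
      using tw[of f id] field_automorphism_id by (simp add: GL_iff)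
    with C show "C \<in> kernel ?G Aut tw" by (simp add: kernel_def Aut_def)
  qed
  moreover have "card (rcosets\<^bsub>?G\<^esub> (kernel ?G Aut tw)) = card (tw ` H)"
    using card_rcosets_kernel[OF T.group_hom_axioms] by simp
  moreover have "tw ` H = twists (semilinear_preimage H)"
  proof (intro subset_antisym subsetI)
    fix \<sigma> assume "\<sigma> \<in> tw ` H"
    then obtain C where "C \<in> H" "\<sigma> = tw C" by blast
    then show "\<sigma> \<in> twists (semilinear_preimage H)" using rep[of C] by (auto simp: twists_def)
  next
    fix \<sigma> assume "\<sigma> \<in> twists (semilinear_preimage H)"
    then obtain f where f: "f \<in> semilinear_preimage H" "field_automorphism \<sigma>" "semilinear_for \<sigma> f"
      by (auto simp: twists_def)
    then have "bij f" "scalars #>\<^bsub>GammaL\<^esub> f \<in> H" by (auto simp: semilinear_preimage_def GammaL_def)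
    with tw[OF _ f(2,3)] show "\<sigma> \<in> tw ` H" by force
  qed
  ultimately show ?thesis by (simp add: group_index_def)
qed

section \<open>Small bases and the upper bound\<close>

text \<open>\<open>I\<close> is a base for the linear maps. \<open>J\<close> is chosen so that the
  field automorphism of any \<open>f\<close> stabilising the members in \<open>I \<union> J\<close>
  is also realised, for each \<open>j\<close>, by some \<open>g\<close> stabilising
  \<open>X j\<close> and the members in \<open>I\<close>; then the inverse of \<open>g\<close> after
  \<open>f\<close> is linear, and the property of \<open>I\<close> applies to it.\<close>

lemma semilinear_stabilizer_base:
  fixes X :: "'i \<Rightarrow> ('a::{field,finite} ^ 'n) set"
  assumes N: "finite N" "N \<noteq> {}" and m: "m \<ge> 1"
    and X: "\<And>i. i \<in> N \<Longrightarrow> X i \<in> subspaces_of_dim m"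
    and K: "id \<in> K" "\<And>f g. f \<in> K \<Longrightarrow> g \<in> K \<Longrightarrow> f \<circ> g \<in> K"
      "\<And>f. f \<in> K \<Longrightarrow> inv_into UNIV f \<in> K" "K \<subseteq> carrier GammaL"
  shows "\<exists>I\<subseteq>N. card I + 2 * m \<le> (m + 1) * CARD('n) + 1 + card (prime_factors (card (twists K))) \<and>
    (\<forall>f\<in>K. (\<forall>i\<in>I. f ` X i = X i) \<longrightarrow> (\<forall>i\<in>N. f ` X i = X i))"
proof -
  have "\<exists>I\<subseteq>N. card I + 2 * m \<le> (m + 1) * CARD('n) + 1 \<and>
      (\<forall>f\<in>GL. (\<forall>i\<in>I. f ` X i = X i) \<longrightarrow> (\<forall>i\<in>N. f ` X i = X i))"
    by (rule GL_stabilizer_base[OF N m]) (rule X)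
  then obtain I where I: "I \<subseteq> N" "card I + 2 * m \<le> (m + 1) * CARD('n) + 1"
    and stab: "\<forall>f\<in>GL. (\<forall>i\<in>I. f ` X i = X i) \<longrightarrow> (\<forall>i\<in>N. f ` X i = X i)"
    by (elim exE conjE) (rule that)
  have fix_I: "f ` X i = X i" if "f \<in> GL" "\<And>i. i \<in> I \<Longrightarrow> f ` X i = X i" "i \<in> N" for f i
    using stab that by meson
  have bijK: "bij f" and slK: "semilinear f" if "f \<in> K" for f
    using that K(4) by (auto simp: GammaL_def)
  define St where "St L = {f \<in> K. \<forall>i\<in>L. f ` X i = X i}" for L
  have St: "aut_subgroup (twists (St L))" for L
  proof (rule aut_subgroup_twists)
    show "id \<in> St L" using K(1) by (simp add: St_def)
    show "f \<circ> g \<in> St L" if "f \<in> St L" "g \<in> St L" for f g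
    proof -
      have "(f \<circ> g) ` X i = X i" if "i \<in> L" for i
        unfolding image_comp[symmetric] using that \<open>f \<in> St L\<close> \<open>g \<in> St L\<close> by (simp add: St_def)
      then show ?thesis using that K(2) by (simp add: St_def)
    qed
    show "inv_into UNIV f \<in> St L" if f: "f \<in> St L" for f
    proof -
      have "inv_into UNIV f ` X i = X i" if "i \<in> L" for i
      proof -
        have "inv_into UNIV f ` f ` X i = X i"
          using f bijK by (simp add: St_def image_image bij_is_inj)
        then show ?thesis using f that by (simp add: St_def)
      qed
      then show ?thesis using f K(3) by (simp add: St_def)
    qed
    show "bij f" if "f \<in> St L" for f using that bijK by (simp add: St_def)
  qed
  have mono: "twists (St L) \<subseteq> twists (St M)" if "M \<subseteq> L" for L M
    using that unfolding twists_def St_def by blast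
  have St0: "St {} = K" by (simp add: St_def)
  \<comment> \<open>\<open>S\<^sub>0\<close> is taken to be the twists of all of \<open>K\<close>,
    so that the size of \<open>J\<close> is governed by \<open>card (twists K)\<close>.\<close>
  have "\<exists>J\<subseteq>N. card J \<le> card (prime_factors (card (twists (St {})))) \<and>
      twists (St I) \<inter> (\<Inter>j\<in>J. twists (St (insert j I))) \<subseteq> (\<Inter>j\<in>N. twists (St (insert j I)))"
    by (rule aut_subgroups_Inter[OF St St mono[OF empty_subsetI] N(1) St])
  then obtain J where J: "J \<subseteq> N" "card J \<le> card (prime_factors (card (twists K)))"
    "twists (St I) \<inter> (\<Inter>j\<in>J. twists (St (insert j I))) \<subseteq> (\<Inter>j\<in>N. twists (St (insert j I)))"
    unfolding St0 by (elim exE conjE) (rule that)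
  have "f ` X j = X j" if f: "f \<in> K" "\<And>i. i \<in> I \<union> J \<Longrightarrow> f ` X i = X i" and j: "j \<in> N" for f j
  proof -
    obtain \<sigma> where \<sigma>: "field_automorphism \<sigma>" "semilinear_for \<sigma> f"
      using slK[OF f(1)] by (auto simp: semilinear_iff)
    have "f \<in> St I" "\<And>i. i \<in> J \<Longrightarrow> f \<in> St (insert i I)" using f by (auto simp: St_def)
    then have "\<sigma> \<in> twists (St I) \<inter> (\<Inter>j\<in>J. twists (St (insert j I)))"
      using \<sigma> by (auto simp: twists_def)
    then have "\<sigma> \<in> twists (St (insert j I))" using J(3) j by blast
    then obtain g where g: "g \<in> K" "semilinear_for \<sigma> g" "g ` X j = X j" "\<And>i. i \<in> I \<Longrightarrow> g ` X i = X i"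
      by (auto simp: twists_def St_def)
    let ?h = "inv_into UNIV g \<circ> f"
    have b: "bij \<sigma>" using \<sigma>(1) by (simp add: field_automorphism_def)
    have "semilinear_for (inv_into UNIV \<sigma> \<circ> \<sigma>) ?h"
      by (intro semilinear_for_comp semilinear_for_inv g \<sigma> bijK b)
    moreover have "inv_into UNIV \<sigma> \<circ> \<sigma> = id" using b by (simp add: bij_is_inj)
    moreover have "bij ?h" using bijK K(2,3) f(1) g(1) by blast
    ultimately have "?h \<in> GL" by (simp add: GL_iff)
    moreover have inv_g: "inv_into UNIV g ` g ` S = S" "g ` inv_into UNIV g ` S = S" for S
      using bijK[OF g(1)] by (simp_all add: image_image bij_is_inj bij_is_surj surj_f_inv_f)
    have "?h ` X i = X i" if "i \<in> I" for i
      unfolding image_comp[symmetric] using inv_g(1)[of "X i"] g(4)[OF that] f(2)[of i] that by simp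
    ultimately have "?h ` X j = X j" using j by (rule fix_I)
    then have "g ` inv_into UNIV g ` f ` X j = g ` X j" by (simp only: image_comp)
    then show ?thesis using inv_g(2) g(3) by simp
  qed
  moreover have "card (I \<union> J) + 2 * m \<le> (m + 1) * CARD('n) + 1 + card (prime_factors (card (twists K)))"
    using card_Un_le[of I J] I(2) J(2) by linarith
  ultimately show ?thesis using I(1) J(1) by (intro exI[of _ "I \<union> J"]) auto
qed

text \<open>The effect on \<open>X\<close> of an element of \<open>H\<close> is determined by its
  effect on a base \<open>I\<close>. Since \<open>|I| < r\<close>, any further position
  \<open>l\<close> can be matched together with \<open>I\<close>, and all resulting elements act
  alike on \<open>X\<close>.\<close>

lemma RC_bound_subspaces:
  fixes H :: "('a::{field,finite} ^ 'n \<Rightarrow> 'a ^ 'n) set set"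
  assumes H: "subgroup H PGammaL" and m: "m \<ge> 1"
    and r: "r + 2 * m = (m + 1) * CARD('n) + 2 + card (prime_factors (group_index PGammaL H (H \<inter> PGL)))"
    and "r \<ge> 1"
  shows "RC_bound H (subspaces_of_dim m) (subspace_action m) r"
proof -
  have "\<exists>C\<in>H. map (subspace_action m C) X = Y"
    if k: "r \<le> k" "length X = k" "length Y = k" and X: "set X \<subseteq> subspaces_of_dim m"
      and eq: "r_equivalent r H (subspace_action m) X Y" for k X Y
  proof -
    let ?K = "semilinear_preimage H"
    have H_rep: "H = (\<lambda>f. scalars #>\<^bsub>GammaL\<^esub> f) ` ?K"
      by (rule semilinear_preimage_rep[OF subgroup.subset[OF H]])
    have K: "?K \<subseteq> carrier GammaL" by (auto simp: semilinear_preimage_def)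
    have act: "subspace_action m (scalars #>\<^bsub>GammaL\<^esub> f) (X ! i) = f ` (X ! i)"
      if "f \<in> ?K" "i < k" for f i
      using that X k K by (intro subspace_action_eq) auto
    have ne: "{..<k} \<noteq> {}" using k(1) \<open>r \<ge> 1\<close> by (simp add: lessThan_empty_iff)
    have "\<exists>I\<subseteq>{..<k}. card I + 2 * m \<le> (m + 1) * CARD('n) + 1 + card (prime_factors (card (twists ?K))) \<and>
        (\<forall>f\<in>?K. (\<forall>i\<in>I. f ` (X ! i) = X ! i) \<longrightarrow> (\<forall>i\<in>{..<k}. f ` (X ! i) = X ! i))"
    proof (rule semilinear_stabilizer_base[OF finite_lessThan ne m])
      show "X ! i \<in> subspaces_of_dim m" if "i \<in> {..<k}" for i
        using that X k(2) by (metis lessThan_iff nth_mem subsetD)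
    qed (use K semilinear_preimage_closed[OF H] in auto)
    then obtain I where I: "I \<subseteq> {..<k}"
      and cI: "card I + 2 * m \<le> (m + 1) * CARD('n) + 1 + card (prime_factors (card (twists ?K)))"
      and stab: "\<forall>f\<in>?K. (\<forall>i\<in>I. f ` (X ! i) = X ! i) \<longrightarrow> (\<forall>i\<in>{..<k}. f ` (X ! i) = X ! i)"
      by (elim exE conjE) (rule that)
    have cI: "card I < r"
      using r cI unfolding group_index_PGL[OF H] by linarith
    have fix_I: "f ` (X ! i) = X ! i" if "f \<in> ?K" "\<And>i. i \<in> I \<Longrightarrow> f ` (X ! i) = X ! i" "i < k" for f i
      using stab that by (meson lessThan_iff)
    have move: "\<exists>f\<in>?K. \<forall>i\<in>insert l I. f ` (X ! i) = Y ! i" if "l < k" for l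
    proof -
      have fin: "finite I" using I finite_subset by blast
      have "insert l I \<subseteq> {..<k}" "card (insert l I) \<le> r"
        using that I cI fin by (auto simp: card_insert_if)
      \<comment> \<open>\<open>r\<close>-equivalence speaks of subsets of exactly \<open>r\<close>
        positions, so \<open>insert l I\<close> is enlarged to that size.\<close>
      then obtain L where L: "insert l I \<subseteq> L" "L \<subseteq> {..<k}" "card L = r"
        using exists_subset_between[of "insert l I" r "{..<k}"] k by auto
      then obtain C where C: "C \<in> H" "\<forall>i\<in>L. subspace_action m C (X ! i) = Y ! i"
        using eq k(2) unfolding r_equivalent_def by blast
      then obtain f where f: "f \<in> ?K" "C = scalars #>\<^bsub>GammaL\<^esub> f" using H_rep by blast
      have "f ` (X ! i) = Y ! i" if "i \<in> insert l I" for i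
      proof -
        have "i \<in> L" "i < k" using that L by auto
        then show ?thesis using C(2) act[OF f(1)] f(2) by metis
      qed
      then show ?thesis using f(1) by blast
    qed
    \<comment> \<open>Only the values on \<open>I\<close> are kept; position 0 exists because
      \<open>r \<ge> 1\<close>.\<close>
    obtain f where f: "f \<in> ?K" "\<And>i. i \<in> I \<Longrightarrow> f ` (X ! i) = Y ! i"
      using move[of 0] k(1) \<open>r \<ge> 1\<close> by auto
    have "f ` (X ! l) = Y ! l" if l: "l < k" for l
    proof -
      obtain g where g: "g \<in> ?K" "\<And>i. i \<in> insert l I \<Longrightarrow> g ` (X ! i) = Y ! i"
        using move[OF l] by blast
      have bij: "bij g" using g(1) by (auto simp: semilinear_preimage_def GammaL_def)
      have inv_g: "inv_into UNIV g ` g ` S = S" "g ` inv_into UNIV g ` S = S" for S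
        using bij by (simp_all add: image_image bij_is_inj bij_is_surj surj_f_inv_f)
      let ?h = "inv_into UNIV g \<circ> f"
      have "?h \<in> ?K" using semilinear_preimage_closed(2,3)[OF H] f(1) g(1) by blast
      moreover have "?h ` (X ! i) = X ! i" if "i \<in> I" for i
        unfolding image_comp[symmetric] f(2)[OF that] using g(2)[of i] that inv_g(1)[of "X ! i"] by simp
      ultimately have "?h ` (X ! l) = X ! l" using l by (rule fix_I)
      then have "g ` inv_into UNIV g ` f ` (X ! l) = g ` (X ! l)" by (simp only: image_comp)
      then show ?thesis using inv_g(2) g(2)[of l] by simp
    qed
    then have "map (subspace_action m (scalars #>\<^bsub>GammaL\<^esub> f)) X = Y"
      using k act[OF f(1)] by (intro nth_equalityI) auto
    then show ?thesis
      using f(1) by (auto simp: semilinear_preimage_def)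
  qed
  then show ?thesis
    using \<open>r \<ge> 1\<close> unfolding RC_bound_def by simp
qed

theorem theorem3:
  fixes H :: "('a::{field,finite} ^ 'n \<Rightarrow> 'a ^ 'n) set set"
    and q n m e :: nat
  assumes "CARD('a) = q" and "CARD('n) = n"
    and "subgroup H PGammaL" and "PSL \<subseteq> H"
    and "e = group_index PGammaL H (H \<inter> PGL)"
    and "m \<in> {2..n div 2}"
  shows "int m * int n - (int m)\<^sup>2 + 1
           \<le> int (relational_complexity H (subspaces_of_dim m) (subspace_action m))
    \<and> int (relational_complexity H (subspaces_of_dim m) (subspace_action m))
           \<le> (int m + 1) * int n - 2 * int m + 2 + int (card (prime_factors e))"
proof -
  let ?RC = "relational_complexity H (subspaces_of_dim m) (subspace_action m)"
  have m: "2 \<le> m" "2 * m \<le> n" using assms(6) by auto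
  \<comment> \<open>The subtraction is exact, since \<open>2 * m \<le> (m + 1) * n\<close>.\<close>
  define r where "r = (m + 1) * n + 2 + card (prime_factors e) - 2 * m"
  have "2 * m \<le> (m + 1) * n" using m by (simp add: trans_le_add1)
  then have r: "r + 2 * m = (m + 1) * n + 2 + card (prime_factors e)" "1 \<le> r"
    by (simp_all add: r_def)
  have bound: "RC_bound H (subspaces_of_dim m) (subspace_action m) r"
    by (rule RC_bound_subspaces[OF assms(3)]) (use m r assms(2,5) in simp_all)
  then have "?RC \<le> r"
    unfolding relational_complexity_def by (rule Least_le)
  then have "?RC + 2 * m \<le> (m + 1) * n + 2 + card (prime_factors e)"
    using r(1) by linarith
  then have "int (?RC + 2 * m) \<le> int ((m + 1) * n + 2 + card (prime_factors e))"
    by (simp only: of_nat_le_iff)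
  then have upper: "int ?RC \<le> (int m + 1) * int n - 2 * int m + 2 + int (card (prime_factors e))"
    by (simp add: algebra_simps)
  \<comment> \<open>The minimum is attained because \<open>r\<close> qualifies, so the lower bound
    for admissible values applies to the minimum itself.\<close>
  have "RC_bound H (subspaces_of_dim m) (subspace_action m) ?RC"
    unfolding relational_complexity_def using bound by (rule LeastI)
  then have "m * (CARD('n) - m) < ?RC"
    by (intro RC_bound_subspaces_gt[OF subgroup.subset[OF assms(3)] assms(4)]) (use m assms(2) in auto)
  then have "m * (n - m) + 1 \<le> ?RC" using assms(2) by simp
  then have "int (m * (n - m) + 1) \<le> int ?RC"
    by (simp only: of_nat_le_iff)
  then have "int (m * (n - m)) + 1 \<le> int ?RC"
    by (simp only: of_nat_add of_nat_1)
  moreover have "int (m * (n - m)) = int m * int n - (int m)\<^sup>2"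
    using m by (simp add: of_nat_diff power2_eq_square right_diff_distrib)
  ultimately show ?thesis using upper by simp
qed

end
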